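(* Let $d = d(n) \ge 1$ be an integer-valued function with $d(n) = o(\log n)$ and $d(n) = \omega(\log\log n)$ as $n \to \infty$. There are a constant $D > 0$ and sequences $\delta_n \to 0$, $K_n \to \infty$ such that for every sufficiently large $n$ there exist $m = m(n)$ and a set $X \subset \mathbb{R}^m$ with $|X| = n$ and doubling dimension at most $D$ such that the following holds. Let $G : \mathbb{R}^m \to \mathbb{R}^{d}$ be a random projection and let $M$ be the minimum spanning tree cost of $X$. Then with probability at least $2/3$ over $G$ there exists a spanning tree $\mathcal{M}'$ of $GX$ whose cost in $GX$ is at most $(1+\delta_n)$ times the minimum spanning tree cost of $GX$ (i.e. a $(1+o(1))$-approximate minimum spanning tree for $GX$), but whose total cost when pulled back to $X$ is at least $K_n \cdot M$ (i.e. $\omega(1) \cdot M$).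
   Context: All norms are Euclidean. The cost of a spanning tree $T$ on a finite point set $Y$ in a Euclidean space is $\sum_{(x,y)\in T}\|x-y\|$, and the minimum spanning tree cost of $Y$ is the minimum of this over spanning trees. $GX = \{Gx : x\in X\}$. A spanning tree of $GX$ is pulled back to a spanning tree of $X$ via the correspondence $Gx \leftrightarrow x$ (almost surely a bijection), and its cost is then measured with distances in $\mathbb{R}^m$. Doubling dimension: for $x \in X$, $r > 0$ let $B(x,r) = \{y \in X : \|x-y\| \le r\}$. The doubling constant $\lambda_X$ is the smallest $\lambda$ such that for all $x \in X$, $r > 0$ there is $S \subseteq X$ with $|S| \le \lambda$ and $B(x,r) \subseteq \bigcup_{s \in S} B(s, r/2)$. The doubling dimension is $d_X = \log_2 \lambda_X$. A random projection from $\mathbb{R}^m$ to $\mathbb{R}^d$ is a random linear map $G$ given by a $d \times m$ matrix with i.i.d. entries drawn from $\mathcal{N}(0, 1/d)$ (variance $1/d$). *)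

theory Defs
  imports "HOL-Probability.Probability" "HOL-Library.Landau_Symbols"
begin

text \<open>
  The dimensions \<open>m\<close> and \<open>d\<close> vary inside the statement, so \<open>\<real>\<^sup>m\<close> is taken to be the carrier
  \<open>topspace (Euclidean_space m)\<close>, i.e. the functions \<open>nat \<Rightarrow> real\<close> vanishing outside \<open>{..<m}\<close>.
\<close>

abbreviation Rvec :: "nat \<Rightarrow> (nat \<Rightarrow> real) set" where
  "Rvec m \<equiv> topspace (Euclidean_space m)"

definition edist :: "nat \<Rightarrow> (nat \<Rightarrow> real) \<Rightarrow> (nat \<Rightarrow> real) \<Rightarrow> real" where
  "edist m x y = L2_set (\<lambda>i. x i - y i) {..<m}"

lemma edist_commute: "edist m x y = edist m y x"
  by (simp add: edist_def L2_set_def power2_commute)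

lemma mem_Rvec_iff: "x \<in> Rvec m \<longleftrightarrow> (\<forall>i\<ge>m. x i = 0)"
  by (simp add: topspace_Euclidean_space)


subsection \<open>Spanning trees\<close>

text \<open>
  An undirected edge is a two-element set of vertices, and a spanning tree is given by its edge
  set. (\<open>spanning_tree\<close> of the AFP entry Graph_Theory only excludes directed cycles: a transitively
  oriented triangle is a tree there.)
\<close>

definition graph_connected :: "'a set \<Rightarrow> 'a set set \<Rightarrow> bool" where
  "graph_connected V E \<longleftrightarrow> (\<forall>u\<in>V. \<forall>v\<in>V. (u, v) \<in> {(a, b). {a, b} \<in> E}\<^sup>*)"

definition is_cycle :: "'a set set \<Rightarrow> 'a list \<Rightarrow> bool" where
  "is_cycle E vs \<longleftrightarrow> 3 \<le> length vs \<and> distinct vs \<and>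
     (\<forall>i<length vs. {vs ! i, vs ! (Suc i mod length vs)} \<in> E)"

definition is_spanning_tree :: "'a set \<Rightarrow> 'a set set \<Rightarrow> bool" where
  "is_spanning_tree V T \<longleftrightarrow>
     T \<subseteq> {{u, v} | u v. u \<in> V \<and> v \<in> V \<and> u \<noteq> v} \<and>
     graph_connected V T \<and> (\<nexists>vs. is_cycle T vs)"

text \<open>Well-defined on edges because it is only used for symmetric \<open>\<rho>\<close>.\<close>

definition edge_length :: "('a \<Rightarrow> 'a \<Rightarrow> real) \<Rightarrow> 'a set \<Rightarrow> real" where
  "edge_length \<rho> e = (THE r. \<exists>u v. e = {u, v} \<and> r = \<rho> u v)"

lemma edge_length_eq:
  assumes "\<And>x y. \<rho> x y = \<rho> y x"
  shows "edge_length \<rho> {u, v} = \<rho> u v"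
  unfolding edge_length_def using assms by (intro the_equality) (auto simp: doubleton_eq_iff)

lemma edge_length_edist: "edge_length (edist m) {u, v} = edist m u v"
  by (rule edge_length_eq) (rule edist_commute)

definition tree_cost :: "('a \<Rightarrow> 'a \<Rightarrow> real) \<Rightarrow> 'a set set \<Rightarrow> real" where
  "tree_cost \<rho> T = (\<Sum>e\<in>T. edge_length \<rho> e)"

definition mst_cost :: "('a \<Rightarrow> 'a \<Rightarrow> real) \<Rightarrow> 'a set \<Rightarrow> real" where
  "mst_cost \<rho> V = Min {tree_cost \<rho> T | T. is_spanning_tree V T}"

text \<open>Meaningful when \<open>f\<close> is injective on \<open>X\<close> and \<open>T\<close> is a graph on \<open>f ` X\<close>.\<close>

definition pull_back :: "('a \<Rightarrow> 'b) \<Rightarrow> 'a set \<Rightarrow> 'b set set \<Rightarrow> 'a set set" where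
  "pull_back f X T = (\<lambda>e. inv_into X f ` e) ` T"


subsection \<open>Doubling dimension\<close>

definition sub_ball :: "('a \<Rightarrow> 'a \<Rightarrow> real) \<Rightarrow> 'a set \<Rightarrow> 'a \<Rightarrow> real \<Rightarrow> 'a set" where
  "sub_ball \<rho> X x r = {y \<in> X. \<rho> x y \<le> r}"

text \<open>For finite \<open>X\<close> the least element exists, since \<open>S = X\<close> is always a valid choice.\<close>

definition doubling_constant :: "('a \<Rightarrow> 'a \<Rightarrow> real) \<Rightarrow> 'a set \<Rightarrow> nat" where
  "doubling_constant \<rho> X = (LEAST k. \<forall>x\<in>X. \<forall>r>0.
     \<exists>S\<subseteq>X. finite S \<and> card S \<le> k \<and> sub_ball \<rho> X x r \<subseteq> (\<Union>s\<in>S. sub_ball \<rho> X s (r / 2)))"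

definition doubling_dim :: "('a \<Rightarrow> 'a \<Rightarrow> real) \<Rightarrow> 'a set \<Rightarrow> real" where
  "doubling_dim \<rho> X = log 2 (real (doubling_constant \<rho> X))"


subsection \<open>Random projections\<close>

text \<open>
  The law of a \<open>d \<times> m\<close> matrix with i.i.d. entries of variance \<open>1 / d\<close>; the second parameter of
  \<^const>\<open>normal_density\<close> is the standard deviation.
\<close>

definition gaussian_matrix :: "nat \<Rightarrow> nat \<Rightarrow> (nat \<times> nat \<Rightarrow> real) measure" where
  "gaussian_matrix d m =
     (\<Pi>\<^sub>M ij\<in>{..<d} \<times> {..<m}. density lborel (\<lambda>x. ennreal (normal_density 0 (1 / sqrt (real d)) x)))"

definition lin_map :: "nat \<Rightarrow> nat \<Rightarrow> (nat \<times> nat \<Rightarrow> real) \<Rightarrow> (nat \<Rightarrow> real) \<Rightarrow> (nat \<Rightarrow> real)" where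
  "lin_map d m A x = (\<lambda>i. if i < d then \<Sum>j<m. A (i, j) * x j else 0)"

lemma prob_space_gaussian_matrix:
  assumes "d \<ge> 1"
  shows "prob_space (gaussian_matrix d m)"
  unfolding gaussian_matrix_def using assms
  by (intro prob_space_PiM prob_space_normal_density) auto

lemma lin_map_in_Rvec: "lin_map d m A x \<in> Rvec d"
  by (simp add: mem_Rvec_iff lin_map_def)

end

theory Submission
  imports Defs
begin

text \<open>
  Let \<open>x\<^sub>t = e\<^sub>0 + \<dots> + e\<^sub>t\<^sub>-\<^sub>1\<close> for \<open>t \<le> P\<close>, replace each \<open>x\<^sub>t\<close> by a tiny cluster of points on a line in the
  direction \<open>u = e\<^sub>P\<close>, and add a tiny cluster at \<open>P u\<close>. The set is a subset of a snowflake times a line,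
  hence doubling, and its minimum spanning tree costs at most \<open>3P\<close>. The last cluster forces the
  minimum spanning tree of the image to cost at least \<open>P \<parallel>G u\<parallel>\<close>, where \<open>\<parallel>G u\<parallel>\<close> is bounded below with
  high probability. On the other hand the steps \<open>G e\<^sub>t\<close> are independent, and each has norm at most
  \<open>3 / B\<close> with probability at least \<open>B\<^sup>-\<^sup>d\<close>; so with \<open>P \<ge> 2 B\<^sup>d\<close> some step is that short. Hanging
  \<open>N = 3 \<kappa> P\<close> points of cluster \<open>t + 1\<close> on the center of cluster \<open>t\<close> then costs almost nothing in the
  image, but \<open>N\<close> in the original space. All of this fits into \<open>n = B\<^sup>4\<^sup>d\<close> points, and \<open>B \<rightarrow> \<infinity>\<close> because
  \<open>d = o(log n)\<close>.
\<close>

subsection \<open>Spanning trees in finite pseudometric spaces\<close>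

lemma is_spanning_treeD:
  assumes "is_spanning_tree V T"
  shows "T \<subseteq> {{u, v} | u v. u \<in> V \<and> v \<in> V \<and> u \<noteq> v}" "graph_connected V T" "\<not> is_cycle T vs"
  using assms by (auto simp: is_spanning_tree_def)

lemma spanning_tree_edges_in_Pow: "is_spanning_tree V T \<Longrightarrow> T \<subseteq> Pow V"
  by (auto simp: is_spanning_tree_def)

lemma adjacency_rtrancl_sym:
  assumes "(a, b) \<in> {(a, b). {a, b} \<in> E}\<^sup>*"
  shows "(b, a) \<in> {(a, b). {a, b} \<in> E}\<^sup>*"
proof -
  have "sym {(a, b). {a, b} \<in> E}"
    by (auto simp: sym_def insert_commute)
  then show ?thesis
    using assms by (meson symD sym_rtrancl)
qed

lemma graph_connectedI:
  assumes "\<And>v. v \<in> V \<Longrightarrow> (v, r) \<in> {(a, b). {a, b} \<in> E}\<^sup>*"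
  shows "graph_connected V E"
  unfolding graph_connected_def
proof (intro ballI)
  fix u v assume "u \<in> V" "v \<in> V"
  then show "(u, v) \<in> {(a, b). {a, b} \<in> E}\<^sup>*"
    using assms[of u] adjacency_rtrancl_sym[OF assms[of v]] by (rule_tac rtrancl_trans)
qed

lemma spanning_tree_singleton: "is_spanning_tree {r} {}"
proof -
  have "\<not> is_cycle {} vs" for vs :: "'a list"
    by (auto simp: is_cycle_def intro!: exI[of _ 0])
  then show ?thesis
    by (auto simp: is_spanning_tree_def graph_connected_def)
qed

text \<open>A cycle that avoids \<open>v\<close> already lies in \<open>T\<close>. In a cycle
  through \<open>v\<close> both cyclic neighbours of \<open>v\<close> must be \<open>u\<close>, the
  only vertex joined to \<open>v\<close>, which contradicts distinctness.\<close>

lemma spanning_tree_add_leaf: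
  assumes T: "is_spanning_tree V T" and u: "u \<in> V" and v: "v \<notin> V"
  shows "is_spanning_tree (insert v V) (insert {v, u} T)"
proof -
  note TD = is_spanning_treeD[OF T]
  have conn: "graph_connected (insert v V) (insert {v, u} T)"
  proof (rule graph_connectedI[where r = u])
    fix x assume "x \<in> insert v V"
    then consider "x = v" | "x \<in> V" by auto
    then show "(x, u) \<in> {(a, b). {a, b} \<in> insert {v, u} T}\<^sup>*"
    proof cases
      case 2
      then have "(x, u) \<in> {(a, b). {a, b} \<in> T}\<^sup>*"
        using TD(2) u by (auto simp: graph_connected_def)
      moreover have "{(a, b). {a, b} \<in> T} \<subseteq> {(a, b). {a, b} \<in> insert {v, u} T}" by auto
      ultimately show ?thesis using rtrancl_mono by blast
    qed auto
  qed
  have other_end: "x = u" if "{v, x} \<in> insert {v, u} T" for x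
    using that TD(1) v u by (auto simp: doubleton_eq_iff)
  have "\<not> is_cycle (insert {v, u} T) vs" for vs
  proof
    assume cyc: "is_cycle (insert {v, u} T) vs"
    define l where "l = length vs"
    have l: "3 \<le> l" "distinct vs"
      and E: "\<And>i. i < l \<Longrightarrow> {vs ! i, vs ! (Suc i mod l)} \<in> insert {v, u} T"
      using cyc by (auto simp: is_cycle_def l_def)
    show False
    proof (cases "v \<in> set vs")
      case False
      have "{vs ! i, vs ! (Suc i mod l)} \<in> T" if i: "i < l" for i
      proof -
        have "Suc i mod l < l" using l(1) by simp
        then have "vs ! i \<noteq> v" "vs ! (Suc i mod l) \<noteq> v"
          using False i nth_mem[of _ vs] unfolding l_def by metis+
        then show ?thesis using E[OF i] by (auto simp: doubleton_eq_iff)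
      qed
      then have "is_cycle T vs" using l by (auto simp: is_cycle_def l_def)
      then show False using TD(3) by blast
    next
      case True
      then obtain i where i: "i < l" "vs ! i = v" by (auto simp: in_set_conv_nth l_def)
      \<comment> \<open>The cyclic successor and predecessor of \<open>i\<close>; they differ
        because a cycle has at least three vertices.\<close>
      define j where "j = (if Suc i = l then 0 else Suc i)"
      define k where "k = (if i = 0 then l - 1 else i - 1)"
      have jk: "j < l" "k < l" "j \<noteq> k" "Suc i mod l = j" "Suc k mod l = i"
        using i(1) l(1) by (auto simp: j_def k_def)
      have "vs ! j = u" using E[OF i(1)] i jk other_end by simp
      moreover have "vs ! k = u"
        using E[OF jk(2)] i jk other_end by (simp add: insert_commute)
      ultimately show False
        using jk l(2) by (metis l_def nth_eq_iff_index_eq)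
    qed
  qed
  then show ?thesis
    unfolding is_spanning_tree_def using conn TD(1) u v by blast
qed

text \<open>With \<open>par k < k\<close>, attaching the points in increasing order always finds the
  parent in place, so every such choice of parents gives a tree. Both the cheap tree of the point
  set and the bad tree have this shape.\<close>

lemma spanning_tree_add_leaves:
  fixes par :: "nat \<Rightarrow> nat"
  assumes T: "is_spanning_tree {..<q} T" and "q \<le> n" and par: "\<And>k. q \<le> k \<Longrightarrow> k < n \<Longrightarrow> par k < k"
  shows "is_spanning_tree {..<n} (T \<union> (\<lambda>k. {k, par k}) ` {q..<n})"
  using assms(2) par
proof (induction n rule: dec_induct)
  case base
  then show ?case using T by simp
next
  case (step n)
  then have IH: "is_spanning_tree {..<n} (T \<union> (\<lambda>k. {k, par k}) ` {q..<n})" by simp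
  have "is_spanning_tree (insert n {..<n}) (insert {n, par n} (T \<union> (\<lambda>k. {k, par k}) ` {q..<n}))"
    using step by (intro spanning_tree_add_leaf[OF IH]) auto
  moreover have "insert n {..<n} = {..<Suc n}" by auto
  moreover have "insert {n, par n} (T \<union> (\<lambda>k. {k, par k}) ` {q..<n}) =
      T \<union> (\<lambda>k. {k, par k}) ` {q..<Suc n}"
    using step(1) by (auto simp: less_Suc_eq)
  ultimately show ?case by simp
qed

text \<open>Symmetry makes \<open>edge_length\<close> well defined and nonnegativity makes costs
  monotone; the bad tree construction asks no more of the original distance.\<close>

locale symmetric_length =
  fixes \<rho> :: "'a \<Rightarrow> 'a \<Rightarrow> real"
  assumes sym: "\<rho> x y = \<rho> y x" and nonneg: "0 \<le> \<rho> x y"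
begin

lemma edge_length: "edge_length \<rho> {x, y} = \<rho> x y"
  by (rule edge_length_eq) (rule sym)

lemma edge_length_nonneg: "e \<in> {{u, v} | u v. P u v} \<Longrightarrow> 0 \<le> edge_length \<rho> e"
  by (auto simp: edge_length nonneg)

lemma tree_cost_mono:
  assumes "finite E" "T \<subseteq> E" "E \<subseteq> {{u, v} | u v. P u v}"
  shows "tree_cost \<rho> T \<le> tree_cost \<rho> E"
  unfolding tree_cost_def
proof (rule sum_mono2)
  fix e assume "e \<in> E - T"
  then have "e \<in> {{u, v} | u v. P u v}" using assms(3) by blast
  then show "0 \<le> edge_length \<rho> e" by (rule edge_length_nonneg)
qed (use assms in auto)

end

text \<open>\<open>k\<close> is the larger endpoint of its edge, so the new edges are pairwise
  distinct; none of them lies inside \<open>{..<q}\<close>, so none is in \<open>T\<close>.\<close>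

lemma tree_cost_add_leaves:
  fixes par :: "nat \<Rightarrow> nat"
  assumes "symmetric_length \<rho>" and T: "is_spanning_tree {..<q} T"
    and par: "\<And>k. q \<le> k \<Longrightarrow> k < n \<Longrightarrow> par k < k"
  shows "tree_cost \<rho> (T \<union> (\<lambda>k. {k, par k}) ` {q..<n}) = tree_cost \<rho> T + (\<Sum>k=q..<n. \<rho> k (par k))"
proof -
  interpret symmetric_length \<rho> by fact
  have inj: "inj_on (\<lambda>k. {k, par k}) {q..<n}"
  proof (rule inj_onI)
    fix k l assume "k \<in> {q..<n}" "l \<in> {q..<n}" "{k, par k} = {l, par l}"
    then show "k = l" using par[of k] par[of l] by (auto simp: doubleton_eq_iff)
  qed
  have "T \<subseteq> Pow {..<q}" using spanning_tree_edges_in_Pow[OF T] .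
  then have "finite T" "T \<inter> (\<lambda>k. {k, par k}) ` {q..<n} = {}"
    by (auto dest: finite_subset)
  then show ?thesis
    using inj by (simp add: tree_cost_def sum.union_disjoint sum.reindex edge_length)
qed

text \<open>Distinct points may have distance zero, so that the image distance pulled back to
  indices qualifies for every matrix, injective or not.\<close>

locale pseudometric_length = symmetric_length +
  assumes zero: "\<rho> x x = 0" and triangle: "\<rho> x z \<le> \<rho> x y + \<rho> y z"
begin

text \<open>
  The tree is grown leaf by leaf inside \<open>E\<close>; carrying the distance bound along the growth avoids
  any discussion of simple paths.
\<close>

lemma connected_contains_spanning_tree:
  assumes "finite V" "V \<noteq> {}" "graph_connected V E"
    and E: "E \<subseteq> {{u, v} | u v. u \<in> V \<and> v \<in> V \<and> u \<noteq> v}"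
  obtains T where "is_spanning_tree V T" "T \<subseteq> E"
    "\<And>x y. x \<in> V \<Longrightarrow> y \<in> V \<Longrightarrow> \<rho> x y \<le> tree_cost \<rho> T"
proof -
  define good where "good W T \<longleftrightarrow> W \<subseteq> V \<and> is_spanning_tree W T \<and> T \<subseteq> E \<and>
    (\<forall>x\<in>W. \<forall>y\<in>W. \<rho> x y \<le> tree_cost \<rho> T)" for W T
  obtain r where r: "r \<in> V" using assms(2) by auto
  have "good {r} {}"
    using r zero spanning_tree_singleton by (auto simp: good_def tree_cost_def)
  have "\<exists>W T. good W T \<and> card W = Suc k" if "Suc k \<le> card V" for k
    using that
  proof (induction k)
    case 0
    then show ?case using \<open>good {r} {}\<close> by (intro exI[of _ "{r}"] exI[of _ "{}"]) auto
  next
    case (Suc k)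
    then obtain W T where W: "good W T" "card W = Suc k" by auto
    have WV: "W \<subseteq> V" and T: "is_spanning_tree W T" and TE: "T \<subseteq> E"
      and dist: "\<And>x y. x \<in> W \<Longrightarrow> y \<in> W \<Longrightarrow> \<rho> x y \<le> tree_cost \<rho> T"
      using W(1) by (auto simp: good_def)
    obtain a where a: "a \<in> W" using W(2) by fastforce
    obtain b where b: "b \<in> V" "b \<notin> W" using WV W(2) Suc.prems
      by (metis Suc_n_not_le_n subsetI subset_antisym)
    have "(a, b) \<in> {(a, b). {a, b} \<in> E}\<^sup>*"
      using a b WV assms(3) by (auto simp: graph_connected_def)
    \<comment> \<open>A walk from inside \<open>W\<close> to the outside has an edge leaving
      \<open>W\<close>; its outer endpoint becomes the next leaf.\<close>
    then have "\<exists>u v. u \<in> W \<and> v \<notin> W \<and> {u, v} \<in> E"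
      using a b(2) by (induction rule: rtrancl_induct) blast+
    then obtain u v where uv: "u \<in> W" "v \<notin> W" "{u, v} \<in> E" by blast
    have v: "v \<in> V" using uv(3) E by (auto simp: doubleton_eq_iff)
    have finT: "finite T"
      using spanning_tree_edges_in_Pow[OF T] finite_subset[OF WV assms(1)]
      by (meson finite_Pow_iff finite_subset)
    have "{v, u} \<notin> T" using uv spanning_tree_edges_in_Pow[OF T] by auto
    then have cost: "tree_cost \<rho> (insert {v, u} T) = \<rho> v u + tree_cost \<rho> T"
      using finT by (simp add: tree_cost_def edge_length)
    have new: "\<rho> x v \<le> \<rho> v u + tree_cost \<rho> T" if "x \<in> W" for x
      using triangle[of x v u] dist[OF that uv(1)] sym[of u v] by simp
    have "tree_cost \<rho> T \<ge> 0" using dist[OF a a] nonneg[of a a] by linarith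
    then have "\<rho> x y \<le> tree_cost \<rho> (insert {v, u} T)" if "x \<in> insert v W" "y \<in> insert v W" for x y
      using that new dist[of x y] nonneg[of v u] zero[of v] sym[of v y] unfolding cost
      by (fastforce simp: add_increasing)
    then have "good (insert v W) (insert {v, u} T)"
      using spanning_tree_add_leaf[OF T uv(1,2)] WV v TE uv(3)
      by (auto simp: good_def insert_commute)
    moreover have "card (insert v W) = Suc (Suc k)"
      using W(2) uv(2) finite_subset[OF WV assms(1)] by simp
    ultimately show ?case by blast
  qed
  from this[of "card V - 1"] obtain W T where W: "good W T" "card W = card V"
    using assms(1,2) by (metis Suc_pred' card_gt_0_iff order_refl)
  then have "W = V" using assms(1) by (auto simp: good_def card_subset_eq)
  then show ?thesis using W(1) that[of T] by (auto simp: good_def)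
qed

lemma spanning_tree_exists:
  fixes V :: "'a set"
  assumes "finite V" "V \<noteq> {}"
  obtains T where "is_spanning_tree V T"
proof -
  have conn: "graph_connected V {{u, v} | u v. u \<in> V \<and> v \<in> V \<and> u \<noteq> v}"
  proof -
    have "(u, v) \<in> {(a, b). {a, b} \<in> {{u, v} | u v. u \<in> V \<and> v \<in> V \<and> u \<noteq> v}}\<^sup>*"
      if "u \<in> V" "v \<in> V" for u v
      using that by (cases "u = v") (auto intro!: r_into_rtrancl)
    then show ?thesis by (auto simp: graph_connected_def)
  qed
  show ?thesis
    by (rule connected_contains_spanning_tree[OF assms(1,2) conn subset_refl]) (rule that)
qed

lemma finite_tree_costs: "finite V \<Longrightarrow> finite {tree_cost \<rho> T | T. is_spanning_tree V T}"
proof -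
  assume "finite V"
  then have "finite (tree_cost \<rho> ` Pow (Pow V))" by simp
  moreover have "{tree_cost \<rho> T | T. is_spanning_tree V T} \<subseteq> tree_cost \<rho> ` Pow (Pow V)"
    using spanning_tree_edges_in_Pow by blast
  ultimately show ?thesis by (rule rev_finite_subset)
qed

lemma mst_cost_le:
  assumes "finite V" "is_spanning_tree V T"
  shows "mst_cost \<rho> V \<le> tree_cost \<rho> T"
  unfolding mst_cost_def using assms by (intro Min_le finite_tree_costs) auto

lemma mst_cost_attained:
  assumes "finite V" "V \<noteq> {}"
  obtains T where "is_spanning_tree V T" "tree_cost \<rho> T = mst_cost \<rho> V"
proof -
  obtain T0 where "is_spanning_tree V T0" using spanning_tree_exists[OF assms(1,2)] .
  then have "mst_cost \<rho> V \<in> {tree_cost \<rho> T | T. is_spanning_tree V T}"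
    unfolding mst_cost_def using finite_tree_costs[OF \<open>finite V\<close>] by (intro Min_in) auto
  then show ?thesis using that by auto
qed

lemma finite_spanning_tree:
  assumes "finite V" "is_spanning_tree V T"
  shows "finite T"
  using spanning_tree_edges_in_Pow[OF assms(2)] assms(1) by (meson finite_Pow_iff finite_subset)

text \<open>The tree grown inside a minimum spanning tree already costs at least every distance.
  Through this bound the remote cluster makes every spanning tree of the image expensive.\<close>

lemma dist_le_mst_cost:
  assumes "finite V" "x \<in> V" "y \<in> V"
  shows "\<rho> x y \<le> mst_cost \<rho> V"
proof -
  have ne: "V \<noteq> {}" using assms(2) by auto
  obtain T where T: "is_spanning_tree V T" "tree_cost \<rho> T = mst_cost \<rho> V"
    by (rule mst_cost_attained[OF assms(1) ne])
  note TD = is_spanning_treeD[OF T(1)]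
  obtain T' where T': "is_spanning_tree V T'" "T' \<subseteq> T"
    and dist: "\<And>x y. x \<in> V \<Longrightarrow> y \<in> V \<Longrightarrow> \<rho> x y \<le> tree_cost \<rho> T'"
    by (rule connected_contains_spanning_tree[OF assms(1) ne TD(2,1)]) (rule that)
  have "\<rho> x y \<le> tree_cost \<rho> T'" using dist assms(2,3) .
  also have "tree_cost \<rho> T' \<le> tree_cost \<rho> T"
    using finite_spanning_tree[OF assms(1) T(1)] T'(2) TD(1) by (rule tree_cost_mono)
  finally show ?thesis using T(2) by simp
qed

end

section \<open>Contraction of clusters and the bad tree\<close>

lemma card_spanning_tree_le:
  assumes "is_spanning_tree {..<n} T"
  shows "card T \<le> n * n"
proof -
  have "T \<subseteq> (\<lambda>(u, v). {u, v}) ` ({..<n} \<times> {..<n})"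
    using is_spanning_treeD(1)[OF assms] by auto
  then show ?thesis
    using surj_card_le[of "{..<n} \<times> {..<n}" T] by simp
qed

text \<open>The condition \<open>c a \<noteq> c b\<close> discards the edges collapsed by
  \<open>c\<close>; a walk is mapped to a walk that stands still on those.\<close>

lemma graph_connected_image:
  assumes "graph_connected V T" and T: "T \<subseteq> Pow V"
  shows "graph_connected (c ` V) {{c a, c b} | a b. {a, b} \<in> T \<and> c a \<noteq> c b}"
proof -
  let ?E = "{{c a, c b} | a b. {a, b} \<in> T \<and> c a \<noteq> c b}"
  have "(c a, c b) \<in> {(a, b). {a, b} \<in> ?E}\<^sup>*" if "(a, b) \<in> {(a, b). {a, b} \<in> T}\<^sup>*" for a b
    using that
  proof (induction rule: rtrancl_induct)
    case (step y z)
    show ?case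
    proof (cases "c y = c z")
      case True then show ?thesis using step by simp
    next
      case False
      then have "(c y, c z) \<in> {(a, b). {a, b} \<in> ?E}" using step(2) by auto
      then show ?thesis using step(3) by (rule_tac rtrancl_into_rtrancl)
    qed
  qed simp
  then show ?thesis using assms(1) by (auto simp: graph_connected_def)
qed

context pseudometric_length
begin

text \<open>Moving both ends of an edge by at most \<tau> lengthens it by at most
  \<open>2 * \<tau>\<close>, and the moved edges still connect the moved points, so they contain a
  spanning tree of them.\<close>

lemma mst_cost_quotient_le:
  fixes c :: "'a \<Rightarrow> 'a"
  assumes "finite V" "V \<noteq> {}" and T: "is_spanning_tree V T"
    and c: "c ` V \<subseteq> V" and near: "\<And>x. x \<in> V \<Longrightarrow> \<rho> x (c x) \<le> \<tau>"
  shows "mst_cost \<rho> (c ` V) \<le> tree_cost \<rho> T + 2 * \<tau> * card T"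
proof -
  note TD = is_spanning_treeD[OF T]
  have finT: "finite T" using finite_spanning_tree[OF assms(1) T] .
  define E where "E = {{c a, c b} | a b. {a, b} \<in> T \<and> c a \<noteq> c b}"
  have TV: "T \<subseteq> Pow V" using spanning_tree_edges_in_Pow[OF T] .
  have conn: "graph_connected (c ` V) E"
    unfolding E_def using graph_connected_image[OF TD(2) TV] .
  have sub: "E \<subseteq> {{u, v} | u v. u \<in> c ` V \<and> v \<in> c ` V \<and> u \<noteq> v}"
    using TV unfolding E_def by blast
  have Eim: "E \<subseteq> (`) c ` T"
  proof
    fix e assume "e \<in> E"
    then obtain a b where "e = c ` {a, b}" "{a, b} \<in> T" by (auto simp: E_def)
    then show "e \<in> (`) c ` T" by blast
  qed
  have fin: "finite (c ` V)" "c ` V \<noteq> {}" using assms(1,2) by auto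
  obtain T' where T': "is_spanning_tree (c ` V) T'" "T' \<subseteq> E"
    by (rule connected_contains_spanning_tree[OF fin conn sub])
  have "mst_cost \<rho> (c ` V) \<le> tree_cost \<rho> T'"
    using fin(1) T'(1) by (rule mst_cost_le)
  also have "\<dots> \<le> tree_cost \<rho> E"
    using finite_subset[OF Eim finite_imageI[OF finT]] T'(2) sub by (rule tree_cost_mono)
  \<comment> \<open>The collapsed edges are put back first; then edges with a common image are
    counted separately.\<close>
  also have "\<dots> \<le> (\<Sum>e\<in>(`) c ` T. edge_length \<rho> e)"
    unfolding tree_cost_def
  proof (rule sum_mono2)
    fix e assume "e \<in> (`) c ` T - E"
    then obtain e' where "e' \<in> T" "e = c ` e'" by blast
    moreover obtain a b where "e' = {a, b}" using \<open>e' \<in> T\<close> TD(1) by blast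
    ultimately show "0 \<le> edge_length \<rho> e" by (simp add: edge_length nonneg)
  qed (use finT Eim in auto)
  also have "\<dots> \<le> (\<Sum>e\<in>T. edge_length \<rho> (c ` e))"
  proof (rule sum_image_le[OF finT, unfolded o_def])
    fix e assume "e \<in> T"
    then obtain a b where "e = {a, b}" using TD(1) by blast
    then show "0 \<le> edge_length \<rho> (c ` e)" by (simp add: edge_length nonneg)
  qed
  also have "\<dots> \<le> (\<Sum>e\<in>T. edge_length \<rho> e + 2 * \<tau>)"
  proof (rule sum_mono)
    fix e assume "e \<in> T"
    then obtain a b where e: "e = {a, b}" "a \<in> V" "b \<in> V" using TD(1) by blast
    have "\<rho> (c a) (c b) \<le> \<rho> (c a) a + (\<rho> a b + \<rho> b (c b))"
      using triangle[of "c a" "c b" a] triangle[of a "c b" b] by linarith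
    also have "\<dots> \<le> \<rho> a b + 2 * \<tau>"
      using near[OF e(2)] near[OF e(3)] sym[of "c a" a] by simp
    finally show "edge_length \<rho> (c ` e) \<le> edge_length \<rho> e + 2 * \<tau>"
      using e(1) by (simp add: edge_length)
  qed
  also have "\<dots> = tree_cost \<rho> T + 2 * \<tau> * card T"
    by (simp add: sum.distrib tree_cost_def)
  finally show ?thesis .
qed

end

text \<open>
  Start from a minimum spanning tree of the cluster centers \<open>{..<q}\<close> and hang every other point on its
  own center, except for \<open>N\<close> points of cluster \<open>t + 1\<close>, which are hung on the center \<open>t\<close>.
\<close>

lemma bad_tree_exists:
  fixes \<sigma> \<rho> :: "nat \<Rightarrow> nat \<Rightarrow> real"
  assumes "pseudometric_length \<sigma>" "symmetric_length \<rho>"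
    and q: "Suc t < q" "q * Suc N \<le> n"
    and near: "\<And>k. k < n \<Longrightarrow> \<sigma> k (k mod q) \<le> \<tau>"
    and short: "\<sigma> (Suc t) t \<le> r"
    and long: "\<And>k. k < n \<Longrightarrow> k mod q = Suc t \<Longrightarrow> 1 \<le> \<rho> k t"
  obtains T where "is_spanning_tree {..<n} T"
    "tree_cost \<sigma> T \<le> mst_cost \<sigma> {..<n} + (2 * real n ^ 2 + n) * \<tau> + N * r"
    "real N \<le> tree_cost \<rho> T"
proof -
  interpret s: pseudometric_length \<sigma> by fact
  interpret r: symmetric_length \<rho> by fact
  have n: "q \<le> n" "0 < n" "0 < q" using q by (cases n; force)+
  have c: "(\<lambda>k. k mod q) ` {..<n} = {..<q}"
  proof
    show "{..<q} \<subseteq> (\<lambda>k. k mod q) ` {..<n}"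
    proof
      fix k assume "k \<in> {..<q}"
      then show "k \<in> (\<lambda>k. k mod q) ` {..<n}" using n by (intro image_eqI[of _ _ k]) auto
    qed
  qed (use n in auto)
  have \<tau>: "0 \<le> \<tau>" using near[of 0] n s.zero by simp
  obtain T1 where T1: "is_spanning_tree {..<n} T1" "tree_cost \<sigma> T1 = mst_cost \<sigma> {..<n}"
    using s.mst_cost_attained[of "{..<n}"] n(2) by (auto simp: lessThan_empty_iff)
  have "mst_cost \<sigma> {..<q} \<le> mst_cost \<sigma> {..<n} + 2 * \<tau> * card T1"
    using s.mst_cost_quotient_le[OF _ _ T1(1), of "\<lambda>k. k mod q" \<tau>] T1(2) c n near by auto
  \<comment> \<open>The crude edge count suffices, because \<tau> will be tiny compared with any
    power of \<open>n\<close> that occurs.\<close>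
  also have "2 * \<tau> * card T1 \<le> 2 * \<tau> * (real n * real n)"
    using card_spanning_tree_le[OF T1(1)] \<tau>
    by (intro mult_left_mono) (simp_all flip: of_nat_mult)
  finally have quot: "mst_cost \<sigma> {..<q} \<le> mst_cost \<sigma> {..<n} + 2 * \<tau> * (real n * real n)" by simp
  obtain T0 where T0: "is_spanning_tree {..<q} T0" "tree_cost \<sigma> T0 = mst_cost \<sigma> {..<q}"
    using s.mst_cost_attained[of "{..<q}"] n(3) by (auto simp: lessThan_empty_iff)
  \<comment> \<open>The value \<open>j = 0\<close> is left out, since \<open>Suc t\<close> is itself
    a center and a vertex of \<open>T0\<close>; \<open>q * Suc N \<le> n\<close> keeps the other
    indices below \<open>n\<close>.\<close>
  define J where "J = (\<lambda>j. Suc t + q * j) ` {1..N}"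
  define par where "par k = (if k \<in> J then t else k mod q)" for k
  define T where "T = T0 \<union> (\<lambda>k. {k, par k}) ` {q..<n}"
  have par: "par k < k" if "q \<le> k" for k
  proof -
    have "k mod q < k" using that mod_less_divisor[OF n(3), of k] by linarith
    then show ?thesis using that q(1) by (auto simp: par_def)
  qed
  have J: "J \<subseteq> {q..<n}"
  proof
    fix k assume "k \<in> J"
    then obtain j where j: "k = Suc t + q * j" "j \<in> {1..N}" unfolding J_def by (elim imageE)
    then have "q * 1 \<le> q * j" "q * j \<le> q * N" by (intro mult_le_mono; simp)+
    then show "k \<in> {q..<n}"
      using q j(1) unfolding atLeastLessThan_iff mult_1_right mult_Suc_right by linarith
  qed
  have Jmod: "k mod q = Suc t" if "k \<in> J" for k
    using that q(1) by (auto simp: J_def)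
  have cardJ: "card J = N"
    unfolding J_def using n by (subst card_image) (auto simp: inj_on_def)
  have "is_spanning_tree {..<n} T"
    unfolding T_def using T0(1) n(1) par by (rule spanning_tree_add_leaves)
  moreover have "tree_cost \<sigma> T \<le> mst_cost \<sigma> {..<n} + (2 * real n ^ 2 + n) * \<tau> + N * r"
  proof -
    \<comment> \<open>A point of \<open>J\<close> reaches \<open>t\<close> through its own center
      \<open>Suc t\<close>, which adds \<open>r\<close> to the usual \<tau>.\<close>
    have "(\<Sum>k=q..<n. \<sigma> k (par k)) \<le> (\<Sum>k=q..<n. \<tau> + (if k \<in> J then r else 0))"
    proof (rule sum_mono)
      fix k assume k: "k \<in> {q..<n}"
      show "\<sigma> k (par k) \<le> \<tau> + (if k \<in> J then r else 0)"
        using near[of k] k s.triangle[of k t "Suc t"] short Jmod[of k] by (auto simp: par_def)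
    qed
    also have "\<dots> = real (n - q) * \<tau> + N * r"
      using J cardJ by (simp add: sum.distrib sum.If_cases Int_absorb1)
    also have "real (n - q) * \<tau> \<le> real n * \<tau>" using \<tau> by (intro mult_right_mono) auto
    finally have "(\<Sum>k=q..<n. \<sigma> k (par k)) \<le> real n * \<tau> + N * r" by simp
    moreover have "tree_cost \<sigma> T = tree_cost \<sigma> T0 + (\<Sum>k=q..<n. \<sigma> k (par k))"
      unfolding T_def using s.symmetric_length_axioms T0(1) par by (intro tree_cost_add_leaves)
    ultimately show ?thesis
      using quot T0(2) by (simp add: algebra_simps power2_eq_square)
  qed
  moreover have "real N \<le> tree_cost \<rho> T"
  proof -
    have "real N = (\<Sum>k\<in>J. 1)" using cardJ by simp
    also have "\<dots> \<le> (\<Sum>k\<in>J. \<rho> k (par k))"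
      using J Jmod by (intro sum_mono) (auto simp: par_def intro!: long)
    also have "\<dots> \<le> (\<Sum>k=q..<n. \<rho> k (par k))"
      using J r.nonneg by (intro sum_mono2) auto
    also have "\<dots> \<le> tree_cost \<rho> T0 + (\<Sum>k=q..<n. \<rho> k (par k))"
      unfolding tree_cost_def le_add_same_cancel2
    proof (rule sum_nonneg)
      fix e assume "e \<in> T0"
      then obtain u v where "e = {u, v}" using is_spanning_treeD(1)[OF T0(1)] by blast
      then show "0 \<le> edge_length \<rho> e" by (simp add: r.edge_length r.nonneg)
    qed
    also have "\<dots> = tree_cost \<rho> T"
      unfolding T_def using r.symmetric_length_axioms T0(1) par
      by (intro tree_cost_add_leaves[symmetric])
    finally show ?thesis .
  qed
  ultimately show ?thesis by (rule that)
qed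

section \<open>Transport of trees and costs along injections\<close>

lemma spanning_tree_image:
  assumes f: "inj_on f V" and T: "is_spanning_tree V T"
  shows "is_spanning_tree (f ` V) ((`) f ` T)"
proof -
  have TV: "T \<subseteq> {{u, v} | u v. u \<in> V \<and> v \<in> V \<and> u \<noteq> v}" and conn: "graph_connected V T"
    and acyclic: "\<not> is_cycle T vs" for vs
    using T by (auto simp: is_spanning_tree_def)
  \<comment> \<open>Injectivity lets edges be reflected, not only mapped forward; this pulls a
    hypothetical cycle in the image back to a cycle in \<open>T\<close>.\<close>
  have edge: "{a, b} \<in> T" if ab: "{f a, f b} \<in> (`) f ` T" "a \<in> V" "b \<in> V" for a b
  proof -
    obtain e where e: "e \<in> T" "{f a, f b} = f ` e" using ab(1) by (elim imageE)
    have "e \<subseteq> V" using e(1) TV by blast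
    moreover have "f ` {a, b} = f ` e" using e(2) by simp
    ultimately have "{a, b} = e"
      using inj_on_image_eq_iff[OF f, of "{a, b}" e] ab(2,3) by simp
    then show ?thesis using e(1) by simp
  qed
  have "(f a, f b) \<in> {(a, b). {a, b} \<in> (`) f ` T}\<^sup>*" if "(a, b) \<in> {(a, b). {a, b} \<in> T}\<^sup>*" for a b
    using that
  proof (induction rule: rtrancl_induct)
    case (step y z)
    then have "f ` {y, z} \<in> (`) f ` T" by blast
    then show ?case using step(3) by (intro rtrancl_into_rtrancl[OF step(3)]) simp
  qed simp
  then have "graph_connected (f ` V) ((`) f ` T)"
    using conn by (auto simp: graph_connected_def)
  moreover have "(`) f ` T \<subseteq> {{u, v} | u v. u \<in> f ` V \<and> v \<in> f ` V \<and> u \<noteq> v}"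
  proof
    fix e assume "e \<in> (`) f ` T"
    then obtain e' where "e' \<in> T" "e = f ` e'" by blast
    moreover obtain u v where "e' = {u, v}" "u \<in> V" "v \<in> V" "u \<noteq> v" using \<open>e' \<in> T\<close> TV by blast
    ultimately show "e \<in> {{u, v} | u v. u \<in> f ` V \<and> v \<in> f ` V \<and> u \<noteq> v}"
      using inj_onD[OF f] by auto
  qed
  moreover have "\<not> is_cycle ((`) f ` T) vs" for vs
  proof
    assume cyc: "is_cycle ((`) f ` T) vs"
    define ws where "ws = map (inv_into V f) vs"
    have vsV: "vs ! i \<in> f ` V" if "i < length vs" for i
    proof -
      have "{vs ! i, vs ! (Suc i mod length vs)} \<in> (`) f ` T" using cyc that by (simp add: is_cycle_def)
      then obtain e where "e \<in> T" "vs ! i \<in> f ` e" by blast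
      then show ?thesis using TV by blast
    qed
    then have set: "set vs \<subseteq> f ` V" by (auto simp: in_set_conv_nth)
    have "is_cycle T ws"
      unfolding is_cycle_def
    proof (intro conjI allI impI)
      show "3 \<le> length ws" using cyc by (simp add: is_cycle_def ws_def)
      show "distinct ws"
        using cyc inj_on_subset[OF inj_on_inv_into[OF subset_refl] set]
        by (simp add: is_cycle_def ws_def distinct_map)
      fix i assume i: "i < length ws"
      then have "i < length vs" by (simp add: ws_def)
      then have i': "i < length vs" "Suc i mod length vs < length vs"
        by (cases vs; simp)+
      show "{ws ! i, ws ! (Suc i mod length ws)} \<in> T"
      proof (rule edge)
        show "{f (ws ! i), f (ws ! (Suc i mod length ws))} \<in> (`) f ` T"
          using i' cyc vsV by (simp add: ws_def is_cycle_def f_inv_into_f)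
      qed (use i' vsV in \<open>simp_all add: ws_def inv_into_into\<close>)
    qed
    then show False using acyclic by blast
  qed
  ultimately show ?thesis by (simp add: is_spanning_tree_def)
qed

text \<open>The converse inclusion is \<open>spanning_tree_image\<close> for the inverse map. Minima
  and existence statements over trees of the image thereby move to the index set.\<close>

lemma spanning_trees_image:
  assumes f: "inj_on f V"
  shows "{T. is_spanning_tree (f ` V) T} = (`) ((`) f) ` {T. is_spanning_tree V T}"
proof -
  have "T \<in> (`) ((`) f) ` {T. is_spanning_tree V T}" if T: "is_spanning_tree (f ` V) T" for T
  proof -
    let ?T = "(`) (inv_into V f) ` T"
    have "is_spanning_tree (inv_into V f ` f ` V) ?T"
      using spanning_tree_image[OF inj_on_inv_into[OF subset_refl] T] .
    moreover have "inv_into V f ` f ` V = V" using f by simp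
    moreover have "(`) f ` ?T = T"
    proof -
      have "f ` inv_into V f ` e = e" if "e \<in> T" for e
      proof -
        have "e \<subseteq> f ` V" using that T by (auto simp: is_spanning_tree_def)
        then show ?thesis by (rule image_inv_into_cancel[OF refl])
      qed
      then show ?thesis by (auto simp: image_image)
    qed
    ultimately show ?thesis by (metis (mono_tags) imageI mem_Collect_eq)
  qed
  then show ?thesis using spanning_tree_image[OF f] by blast
qed

lemma tree_cost_image:
  assumes f: "inj_on f V" and T: "is_spanning_tree V T" and sym: "\<And>x y. \<rho> x y = \<rho> y x"
  shows "tree_cost \<rho> ((`) f ` T) = tree_cost (\<lambda>a b. \<rho> (f a) (f b)) T"
proof -
  have "T \<subseteq> Pow V" using T by (auto simp: is_spanning_tree_def)
  then have "inj_on ((`) f) T" using inj_on_image_Pow[OF f] inj_on_subset by blast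
  then have "tree_cost \<rho> ((`) f ` T) = (\<Sum>e\<in>T. edge_length \<rho> (f ` e))"
    by (simp add: tree_cost_def sum.reindex)
  also have "\<dots> = tree_cost (\<lambda>a b. \<rho> (f a) (f b)) T"
    unfolding tree_cost_def
  proof (rule sum.cong[OF refl])
    fix e assume "e \<in> T"
    then obtain u v where "e = {u, v}" using T by (auto simp: is_spanning_tree_def)
    then show "edge_length \<rho> (f ` e) = edge_length (\<lambda>a b. \<rho> (f a) (f b)) e"
      using edge_length_eq[of \<rho>] edge_length_eq[of "\<lambda>a b. \<rho> (f a) (f b)"] sym by simp
  qed
  finally show ?thesis .
qed

lemma mst_cost_image:
  assumes "inj_on f V" and sym: "\<And>x y. \<rho> x y = \<rho> y x"
  shows "mst_cost \<rho> (f ` V) = mst_cost (\<lambda>a b. \<rho> (f a) (f b)) V"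
proof -
  have "{tree_cost \<rho> T | T. is_spanning_tree (f ` V) T} =
      tree_cost \<rho> ` (`) ((`) f) ` {T. is_spanning_tree V T}"
    unfolding spanning_trees_image[OF assms(1), symmetric] by auto
  also have "\<dots> = (\<lambda>T. tree_cost (\<lambda>a b. \<rho> (f a) (f b)) T) ` {T. is_spanning_tree V T}"
    unfolding image_image[of "tree_cost \<rho>"]
    using tree_cost_image[OF assms(1) _ sym] by (intro image_cong) auto
  also have "\<dots> = {tree_cost (\<lambda>a b. \<rho> (f a) (f b)) T | T. is_spanning_tree V T}"
    by auto
  finally show ?thesis by (simp add: mst_cost_def)
qed

text \<open>The tree in the projected set and its pull-back come from one tree \<open>T\<close> on
  indices, which eliminates \<open>inv_into\<close> from the final event.\<close>

lemma pull_back_image: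
  assumes w: "inj_on w V" and G: "inj_on G (w ` V)" and T: "T \<subseteq> Pow V"
  shows "pull_back G (w ` V) ((`) (\<lambda>k. G (w k)) ` T) = (`) w ` T"
proof -
  have "inv_into (w ` V) G ` G ` w ` e = w ` e" if "e \<in> T" for e
    using that T G by (intro inv_into_image_cancel) auto
  then show ?thesis by (auto simp: pull_back_def image_image)
qed

subsection \<open>Doubling dimension\<close>

lemma doubling_constant_le:
  assumes "\<And>x r. x \<in> X \<Longrightarrow> r > 0 \<Longrightarrow> \<exists>S\<subseteq>X. finite S \<and> card S \<le> k \<and>
     sub_ball \<rho> X x r \<subseteq> (\<Union>s\<in>S. sub_ball \<rho> X s (r / 2))"
  shows "doubling_constant \<rho> X \<le> k"
  unfolding doubling_constant_def by (rule Least_le) (use assms in blast)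

text \<open>One representative from each cell that meets the ball serves as a center, so the centers
  lie in \<open>X\<close> and number at most as many as the cells.\<close>

lemma cover_by_cells:
  fixes cell :: "'a \<Rightarrow> 'b"
  assumes F: "finite F" "card F \<le> k" and cell: "\<And>y. y \<in> sub_ball \<rho> X x r \<Longrightarrow> cell y \<in> F"
    and close: "\<And>y z. y \<in> sub_ball \<rho> X x r \<Longrightarrow> z \<in> sub_ball \<rho> X x r \<Longrightarrow> cell y = cell z \<Longrightarrow> \<rho> y z \<le> s"
  shows "\<exists>S\<subseteq>X. finite S \<and> card S \<le> k \<and> sub_ball \<rho> X x r \<subseteq> (\<Union>y\<in>S. sub_ball \<rho> X y s)"
proof -
  let ?B = "sub_ball \<rho> X x r"
  define S where "S = inv_into ?B cell ` cell ` ?B"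
  have SB: "S \<subseteq> ?B" unfolding S_def by (auto intro: inv_into_into)
  have fin: "finite (cell ` ?B)" using F(1) cell by (auto intro: finite_subset)
  have "card S \<le> card (cell ` ?B)" unfolding S_def using fin by (rule card_image_le)
  also have "\<dots> \<le> card F" using F(1) cell by (intro card_mono) auto
  finally have "card S \<le> k" using F(2) by simp
  moreover have "?B \<subseteq> (\<Union>y\<in>S. sub_ball \<rho> X y s)"
  proof
    fix y assume y: "y \<in> ?B"
    let ?z = "inv_into ?B cell (cell y)"
    have "?z \<in> S" "cell ?z = cell y" using y by (auto simp: S_def f_inv_into_f)
    then have "\<rho> ?z y \<le> s" using SB y close by blast
    then show "y \<in> (\<Union>y\<in>S. sub_ball \<rho> X y s)"
      using \<open>?z \<in> S\<close> y by (auto simp: sub_ball_def)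
  qed
  moreover have "S \<subseteq> X" using SB by (auto simp: sub_ball_def)
  moreover have "finite S" using fin by (simp add: S_def)
  ultimately show ?thesis by (intro exI[of _ S] conjI)
qed

text \<open>The distance is the Euclidean product of a square-root snowflake of the line with a
  line. A ball of radius \<open>r\<close> restricts \<tau> to within \<open>r\<^sup>2\<close> and
  \<open>y\<close> to within \<open>r\<close>; cells of sides \<open>r\<^sup>2 / 8\<close> and
  \<open>r / 4\<close> have diameter at most \<open>r / 2\<close>, and 17 * 9 = 153 of them
  suffice.\<close>

lemma snowflake_line_doubling:
  fixes \<tau> y :: "'a \<Rightarrow> real"
  assumes \<rho>: "\<And>a b. a \<in> X \<Longrightarrow> b \<in> X \<Longrightarrow> \<rho> a b = sqrt (\<bar>\<tau> a - \<tau> b\<bar> + (y a - y b)\<^sup>2)"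
  shows "doubling_constant \<rho> X \<le> 153"
proof (rule doubling_constant_le)
  fix x and r :: real assume x: "x \<in> X" and r: "r > 0"
  define cell where "cell a = (\<lfloor>8 * (\<tau> a - \<tau> x) / r\<^sup>2\<rfloor>, \<lfloor>4 * (y a - y x) / r\<rfloor>)" for a
  show "\<exists>S\<subseteq>X. finite S \<and> card S \<le> 153 \<and> sub_ball \<rho> X x r \<subseteq> (\<Union>s\<in>S. sub_ball \<rho> X s (r / 2))"
  proof (rule cover_by_cells)
    show "finite ({- 8..8::int} \<times> {- 4..4::int})" "card ({- 8..8::int} \<times> {- 4..4::int}) \<le> 153" by auto
  next
    fix a assume a: "a \<in> sub_ball \<rho> X x r"
    then have "sqrt (\<bar>\<tau> x - \<tau> a\<bar> + (y x - y a)\<^sup>2) \<le> r" using \<rho>[OF x, of a] by (auto simp: sub_ball_def)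
    then have le: "\<bar>\<tau> x - \<tau> a\<bar> + (y x - y a)\<^sup>2 \<le> r\<^sup>2" using r by (simp add: sqrt_le_D)
    then have "\<bar>\<tau> x - \<tau> a\<bar> \<le> r\<^sup>2" "(y x - y a)\<^sup>2 \<le> r\<^sup>2" by (smt (verit) zero_le_power2)+
    moreover have "\<bar>y x - y a\<bar> \<le> r" using \<open>(y x - y a)\<^sup>2 \<le> r\<^sup>2\<close> r abs_le_square_iff[of "y x - y a" r] by simp
    ultimately have "- 8 \<le> 8 * (\<tau> a - \<tau> x) / r\<^sup>2" "8 * (\<tau> a - \<tau> x) / r\<^sup>2 \<le> 8"
      "- 4 \<le> 4 * (y a - y x) / r" "4 * (y a - y x) / r \<le> 4"
      using r by (auto simp: field_simps)
    then show "cell a \<in> {- 8..8} \<times> {- 4..4}"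
      by (auto simp: cell_def le_floor_iff floor_le_iff)
  next
    fix a b assume ab: "a \<in> sub_ball \<rho> X x r" "b \<in> sub_ball \<rho> X x r" "cell a = cell b"
    have diff: "\<bar>u - v\<bar> \<le> 1" if "\<lfloor>u\<rfloor> = \<lfloor>v\<rfloor>" for u v :: real using that by linarith
    have "\<bar>8 * (\<tau> a - \<tau> x) / r\<^sup>2 - 8 * (\<tau> b - \<tau> x) / r\<^sup>2\<bar> \<le> 1"
      "\<bar>4 * (y a - y x) / r - 4 * (y b - y x) / r\<bar> \<le> 1"
      using ab(3) by (auto simp: cell_def intro!: diff)
    moreover have "8 * (\<tau> a - \<tau> x) / r\<^sup>2 - 8 * (\<tau> b - \<tau> x) / r\<^sup>2 = 8 * (\<tau> a - \<tau> b) / r\<^sup>2"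
      "4 * (y a - y x) / r - 4 * (y b - y x) / r = 4 * (y a - y b) / r"
      by (simp_all add: field_simps flip: diff_divide_distrib)
    ultimately have 1: "\<bar>\<tau> a - \<tau> b\<bar> \<le> r\<^sup>2 / 8" and 2: "\<bar>y a - y b\<bar> \<le> \<bar>r / 4\<bar>"
      using r by (auto simp: abs_mult field_simps abs_if split: if_splits)
    have "(y a - y b)\<^sup>2 \<le> (r / 4)\<^sup>2" using 2 by (simp only: abs_le_square_iff)
    moreover have "(r / 4)\<^sup>2 = r\<^sup>2 / 16" "(r / 2)\<^sup>2 = r\<^sup>2 / 4" by (simp_all add: power_divide)
    ultimately have "\<bar>\<tau> a - \<tau> b\<bar> + (y a - y b)\<^sup>2 \<le> (r / 2)\<^sup>2"
      using 1 zero_le_power2[of r] by linarith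
    then have "sqrt (\<bar>\<tau> a - \<tau> b\<bar> + (y a - y b)\<^sup>2) \<le> r / 2" using r by (intro real_le_lsqrt) auto
    then show "\<rho> a b \<le> r / 2" using ab \<rho>[of a b] by (auto simp: sub_ball_def)
  qed
qed

lemma doubling_dim_le:
  assumes "doubling_constant \<rho> X \<le> 2 ^ k"
  shows "doubling_dim \<rho> X \<le> k"
\<comment> \<open>For constant 0 the convention \<open>ln 0 = 0\<close> makes the dimension
  0.\<close>
proof (cases "doubling_constant \<rho> X = 0")
  case False
  have "real (doubling_constant \<rho> X) \<le> real (2 ^ k)" using assms by (rule of_nat_mono)
  then have "log 2 (real (doubling_constant \<rho> X)) \<le> log 2 (2 ^ k)" using False
    by (intro log_mono) auto
  then show ?thesis by (simp add: doubling_dim_def log_nat_power)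
qed (simp add: doubling_dim_def log_def)

subsection \<open>Gaussian matrices\<close>

text \<open>The density is at most \<open>1 / (2 * \<sigma>)\<close> because
  \<open>sqrt (2 * pi) \<ge> 2\<close>, and the interval has length \<open>2 * a\<close>.\<close>

lemma measure_normal_interval_le:
  assumes "0 < \<sigma>" "0 \<le> a"
  shows "measure (density lborel (\<lambda>x. ennreal (normal_density 0 \<sigma> x))) {-a..a} \<le> a / \<sigma>"
proof -
  let ?N = "density lborel (\<lambda>x. ennreal (normal_density 0 \<sigma> x))"
  have "2 = sqrt (2 ^ 2)" by simp
  also have "\<dots> \<le> sqrt (2 * pi)" using pi_gt3 by (intro real_sqrt_le_mono) simp
  finally have "2 * \<sigma> \<le> sqrt (2 * pi * \<sigma>\<^sup>2)"
    using assms by (simp add: real_sqrt_mult mult_right_mono)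
  then have "1 / sqrt (2 * pi * \<sigma>\<^sup>2) \<le> 1 / (2 * \<sigma>)"
    using assms by (intro divide_left_mono) auto
  then have bound: "normal_density 0 \<sigma> x \<le> 1 / (2 * \<sigma>)" for x
    unfolding normal_density_def
    by (intro order_trans[OF mult_right_le_one_le]) (auto intro: divide_nonneg_nonneg)
  have "emeasure ?N {-a..a} = (\<integral>\<^sup>+x. ennreal (normal_density 0 \<sigma> x) * indicator {-a..a} x \<partial>lborel)"
    by (rule emeasure_density) auto
  also have "\<dots> \<le> (\<integral>\<^sup>+x. ennreal (1 / (2 * \<sigma>)) * indicator {-a..a} x \<partial>lborel)"
    using bound by (intro nn_integral_mono mult_right_mono) (auto intro: ennreal_leI)
  also have "\<dots> = ennreal (1 / (2 * \<sigma>)) * ennreal (2 * a)"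
    using assms by (simp add: nn_integral_cmult)
  also have "\<dots> = ennreal (a / \<sigma>)"
    using assms by (simp flip: ennreal_mult'')
  finally show ?thesis
    using assms by (simp add: measure_def enn2real_leI)
qed

text \<open>Within one standard deviation the density is at least \<open>1 / (6 * \<sigma>)\<close>:
  \<open>sqrt (2 * pi) \<le> 3\<close>, and the exponential is at least
  \<open>1 - 1 / 2\<close>.\<close>

lemma measure_normal_interval_ge:
  assumes "0 < \<sigma>" "0 \<le> r" "r \<le> 1"
  shows "r / 3 \<le> measure (density lborel (\<lambda>x. ennreal (normal_density 0 \<sigma> x))) {- (r * \<sigma>)..r * \<sigma>}"
proof -
  let ?N = "density lborel (\<lambda>x. ennreal (normal_density 0 \<sigma> x))"
  interpret N: prob_space ?N using assms by (intro prob_space_normal_density)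
  have "2 * pi * \<sigma>\<^sup>2 \<le> (3 * \<sigma>)\<^sup>2"
    using pi_less_4 mult_right_mono[of "2 * pi" 9 "\<sigma>\<^sup>2"] by (simp add: power_mult_distrib)
  then have s3: "sqrt (2 * pi * \<sigma>\<^sup>2) \<le> 3 * \<sigma>" using assms by (intro real_le_lsqrt) auto
  have bound: "1 / (6 * \<sigma>) \<le> normal_density 0 \<sigma> x" if "\<bar>x\<bar> \<le> r * \<sigma>" for x
  proof -
    have "r * \<sigma> \<le> \<sigma>" using assms by simp
    then have "\<bar>x\<bar> \<le> \<bar>\<sigma>\<bar>" using that by linarith
    then have "x\<^sup>2 \<le> \<sigma>\<^sup>2" by (simp add: abs_le_square_iff)
    then have "1 / 2 \<le> 1 - x\<^sup>2 / (2 * \<sigma>\<^sup>2)" using assms by (simp add: field_simps)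
    also have "\<dots> \<le> exp (- (x\<^sup>2 / (2 * \<sigma>\<^sup>2)))" using exp_ge_add_one_self[of "- (x\<^sup>2 / (2 * \<sigma>\<^sup>2))"] by simp
    finally have e: "1 / 2 \<le> exp (- x\<^sup>2 / (2 * \<sigma>\<^sup>2))" by simp
    have "1 / (6 * \<sigma>) = 1 / (3 * \<sigma>) * (1 / 2)" by simp
    also have "\<dots> \<le> 1 / sqrt (2 * pi * \<sigma>\<^sup>2) * exp (- x\<^sup>2 / (2 * \<sigma>\<^sup>2))"
      using s3 e assms by (intro mult_mono divide_left_mono) auto
    finally show ?thesis by (simp add: normal_density_def)
  qed
  have "ennreal (r / 3) = ennreal (1 / (6 * \<sigma>)) * ennreal (2 * (r * \<sigma>))"
    using assms by (simp flip: ennreal_mult'')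
  also have "\<dots> = (\<integral>\<^sup>+x. ennreal (1 / (6 * \<sigma>)) * indicator {- (r * \<sigma>)..r * \<sigma>} x \<partial>lborel)"
    using assms by (simp add: nn_integral_cmult mult_ac)
  also have "\<dots> \<le> (\<integral>\<^sup>+x. ennreal (normal_density 0 \<sigma> x) * indicator {- (r * \<sigma>)..r * \<sigma>} x \<partial>lborel)"
    using bound by (intro nn_integral_mono) (auto intro!: ennreal_leI split: split_indicator)
  also have "\<dots> = emeasure ?N {- (r * \<sigma>)..r * \<sigma>}"
    by (rule emeasure_density[symmetric]) auto
  finally show ?thesis
    by (simp add: N.emeasure_eq_measure)
qed

text \<open>The joint law of the coordinates is the product measure itself, since restriction to
  \<open>I\<close> is the identity on its space.\<close>

lemma indep_vars_PiM_coordinates: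
  assumes "I \<noteq> {}" and M: "\<And>i. i \<in> I \<Longrightarrow> prob_space (M i)"
  shows "prob_space.indep_vars (Pi\<^sub>M I M) M (\<lambda>i \<omega>. \<omega> i) I"
proof -
  interpret prob_space "Pi\<^sub>M I M" using M by (rule prob_space_PiM)
  have "distr (Pi\<^sub>M I M) (Pi\<^sub>M I M) (\<lambda>x. \<lambda>i\<in>I. x i) = distr (Pi\<^sub>M I M) (Pi\<^sub>M I M) (\<lambda>x. x)"
    by (intro distr_cong) (auto simp: space_PiM PiE_def extensional_restrict)
  also have "\<dots> = Pi\<^sub>M I M" by (rule distr_id2) simp
  also have "\<dots> = (\<Pi>\<^sub>M i\<in>I. distr (Pi\<^sub>M I M) (M i) (\<lambda>\<omega>. \<omega> i))"
    using M by (intro PiM_cong) (simp_all add: distr_PiM_component)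
  finally show ?thesis
    using assms(1) by (subst indep_vars_iff_distr_eq_PiM') auto
qed

section \<open>Columns and rows of the random matrix\<close>

locale random_projection =
  fixes d m :: nat
  assumes d: "d \<ge> 1"
begin

abbreviation "M \<equiv> gaussian_matrix d m"
abbreviation "entry_law \<equiv> density lborel (\<lambda>x. ennreal (normal_density 0 (1 / sqrt (real d)) x))"

sublocale M: prob_space M using d by (rule prob_space_gaussian_matrix)

lemma prob_space_entry: "prob_space entry_law"
  using d by (intro prob_space_normal_density) simp

lemma measurable_entry: "ij \<in> {..<d} \<times> {..<m} \<Longrightarrow> (\<lambda>A. A ij) \<in> borel_measurable M"
  unfolding gaussian_matrix_def
  by (subst measurable_cong_sets[OF refl, of _ entry_law]) (auto intro!: measurable_component_singleton)

lemma prob_entry: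
  assumes "ij \<in> {..<d} \<times> {..<m}" "S \<in> sets borel"
  shows "M.prob ((\<lambda>A. A ij) -` S \<inter> space M) = measure entry_law S"
proof -
  have "distr M entry_law (\<lambda>A. A ij) = entry_law"
    unfolding gaussian_matrix_def using assms(1) prob_space_entry by (intro distr_PiM_component) auto
  moreover have "(\<lambda>A. A ij) \<in> measurable M entry_law"
    unfolding gaussian_matrix_def using assms(1) by (rule measurable_component_singleton)
  ultimately show ?thesis using assms(2) measure_distr[of "\<lambda>A. A ij" M entry_law S] by simp
qed

lemma indep_entries:
  assumes "0 < m"
  shows "M.indep_vars (\<lambda>_. borel) (\<lambda>ij A. A ij) ({..<d} \<times> {..<m})"
proof -
  have "M.indep_vars (\<lambda>_. entry_law) (\<lambda>ij A. A ij) ({..<d} \<times> {..<m})"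
    unfolding gaussian_matrix_def
    using assms d prob_space_entry by (intro indep_vars_PiM_coordinates) (auto simp: lessThan_empty_iff)
  then show ?thesis
    by (rule M.indep_vars_compose2[where Y = "\<lambda>_ x. x"]) auto
qed

text \<open>Entries bounded by \<open>r / sqrt d\<close> give a column of norm at most
  \<open>r\<close>. Each of the \<open>d\<close> independent entries obeys the bound with
  probability at least \<open>r / 3\<close>.\<close>

lemma prob_short_column:
  assumes t: "t < m" and r: "0 \<le> r" "r \<le> 1"
  shows "(r / 3) ^ d \<le> M.prob {A \<in> space M. \<forall>i<d. \<bar>A (i, t)\<bar> \<le> r / sqrt d}"
proof -
  let ?S = "{- (r * (1 / sqrt d))..r * (1 / sqrt d)}" and ?J = "{..<d} \<times> {t}"
  have "(r / 3) ^ d \<le> measure entry_law ?S ^ d"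
    using d r by (intro power_mono measure_normal_interval_ge) auto
  also have "\<dots> = (\<Prod>ij\<in>?J. measure entry_law ?S)" by simp
  also have "\<dots> = (\<Prod>ij\<in>?J. M.prob ((\<lambda>A. A ij) -` ?S \<inter> space M))"
    using t by (intro prod.cong refl prob_entry[symmetric]) auto
  also have "\<dots> = M.prob (\<Inter>ij\<in>?J. (\<lambda>A. A ij) -` ?S \<inter> space M)"
    using d t by (intro M.indep_varsD[OF indep_entries, symmetric]) (auto simp: lessThan_empty_iff)
  also have "(\<Inter>ij\<in>?J. (\<lambda>A. A ij) -` ?S \<inter> space M) = {A \<in> space M. \<forall>i<d. \<bar>A (i, t)\<bar> \<le> r / sqrt d}"
    using d by (fastforce simp: abs_le_iff lessThan_empty_iff minus_le_iff)
  finally show ?thesis .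
qed

text \<open>Distinct columns use disjoint sets of entries and are therefore independent; the product
  of the failure probabilities is bounded by \<open>1 - p \<le> exp (- p)\<close>.\<close>

lemma prob_no_short_column:
  assumes P: "0 < P" "P \<le> m" and r: "0 \<le> r" "r \<le> 1"
  shows "M.prob {A \<in> space M. \<forall>t<P. \<exists>i<d. \<bar>A (i, t)\<bar> > r / sqrt d} \<le> exp (- (real P * (r / 3) ^ d))"
proof -
  \<comment> \<open>\<open>X t\<close> bundles column \<open>t\<close> into one random variable, so
    that independence of blocks of entries applies; \<open>S t\<close> is the set of columns that
    are not short.\<close>
  define X where "X t A = restrict (\<lambda>ij. A ij) ({..<d} \<times> {t})" for t :: nat and A :: "nat \<times> nat \<Rightarrow> real"
  define S where "S t = {x \<in> space (Pi\<^sub>M ({..<d} \<times> {t}) (\<lambda>_. borel :: real measure)).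
    \<not> (\<forall>i<d. \<bar>x (i, t)\<bar> \<le> r / sqrt d)}" for t :: nat
  have indep: "M.indep_vars (\<lambda>t. Pi\<^sub>M ({..<d} \<times> {t}) (\<lambda>_. borel)) X {..<P}"
    unfolding X_def
    by (rule M.indep_vars_restrict[OF indep_entries]) (use P in \<open>auto simp: disjoint_family_on_def\<close>)
  have S: "S t \<in> sets (Pi\<^sub>M ({..<d} \<times> {t}) (\<lambda>_. borel))" for t
  proof -
    have [measurable]: "(\<lambda>x. x (i, t)) \<in> borel_measurable (Pi\<^sub>M ({..<d} \<times> {t}) (\<lambda>_. borel))"
      if "i < d" for i
      using that by (intro measurable_component_singleton) auto
    show ?thesis unfolding S_def by measurable
  qed
  have XS: "X t -` S t \<inter> space M = space M - {A \<in> space M. \<forall>i<d. \<bar>A (i, t)\<bar> \<le> r / sqrt d}" for t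
    by (auto simp: X_def S_def space_PiM)
  have meas: "{A \<in> space M. \<forall>i<d. \<bar>A (i, t)\<bar> \<le> r / sqrt d} \<in> sets M" if "t < m" for t
  proof -
    have [measurable]: "(\<lambda>A. A (i, t)) \<in> borel_measurable M" if "i < d" for i
      using that \<open>t < m\<close> by (intro measurable_entry) auto
    show ?thesis by measurable
  qed
  have "{A \<in> space M. \<forall>t<P. \<exists>i<d. \<bar>A (i, t)\<bar> > r / sqrt d} = (\<Inter>t<P. X t -` S t \<inter> space M)"
  proof -
    have "(\<exists>i<d. \<bar>A (i, t)\<bar> > r / sqrt d) \<longleftrightarrow> \<not> (\<forall>i<d. \<bar>A (i, t)\<bar> \<le> r / sqrt d)"
      for A :: "nat \<times> nat \<Rightarrow> real" and t by (meson not_le)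
    then show ?thesis unfolding XS using P by auto
  qed
  then have "M.prob {A \<in> space M. \<forall>t<P. \<exists>i<d. \<bar>A (i, t)\<bar> > r / sqrt d} =
      (\<Prod>t<P. M.prob (X t -` S t \<inter> space M))"
    using P S by (simp only:) (intro M.indep_varsD[OF indep], auto)
  also have "\<dots> \<le> (\<Prod>t<P. exp (- ((r / 3) ^ d)))"
  proof (rule prod_mono)
    fix t assume "t \<in> {..<P}"
    then have t: "t < m" using P by simp
    have "M.prob (X t -` S t \<inter> space M) \<le> 1 - (r / 3) ^ d"
      unfolding XS using M.prob_compl[OF meas[OF t]] prob_short_column[OF t r] by simp
    also have "\<dots> \<le> exp (- ((r / 3) ^ d))" using exp_ge_add_one_self[of "- ((r / 3) ^ d)"] by simp
    finally show "0 \<le> M.prob (X t -` S t \<inter> space M) \<and> M.prob (X t -` S t \<inter> space M) \<le> exp (- ((r / 3) ^ d))"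
      by simp
  qed
  also have "\<dots> = exp (- (real P * (r / 3) ^ d))"
    using exp_of_nat_mult[of P "- ((r / 3) ^ d)"] by simp
  finally show ?thesis .
qed

text \<open>A norm below 1/32 forces at least three quarters of the entries into the interval of
  radius \<open>1 / (16 * sqrt d)\<close>. Each entry falls there with probability at most 1/16, so
  Markov's inequality for their number \<open>C\<close> gives (1/16) / (3/4) = 1/12, uniformly in
  \<open>d\<close>.\<close>

lemma prob_small_column:
  assumes t: "t < m"
  shows "M.prob {A \<in> space M. L2_set (\<lambda>i. A (i, t)) {..<d} < 1 / 32} \<le> 1 / 12"
proof -
  let ?a = "1 / 16 * (1 / sqrt d)"
  define C where "C A = (\<Sum>i<d. indicator {-?a..?a} (A (i, t)) :: real)" for A :: "nat \<times> nat \<Rightarrow> real"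
  have [measurable]: "(\<lambda>A. A (i, t)) \<in> borel_measurable M" if "i < d" for i
    using that t by (intro measurable_entry) auto
  have int: "integrable M (\<lambda>A. indicator {-?a..?a} (A (i, t)) :: real)" if "i < d" for i
    using that by (intro M.integrable_const_bound[where B = 1]) auto
  have "M.expectation C = (\<Sum>i<d. M.expectation (\<lambda>A. indicator {-?a..?a} (A (i, t))))"
    unfolding C_def using int by (intro Bochner_Integration.integral_sum) auto
  also have "\<dots> \<le> (\<Sum>i<d. 1 / 16)"
  proof (rule sum_mono)
    fix i assume i: "i \<in> {..<d}"
    have "M.expectation (\<lambda>A. indicator {-?a..?a} (A (i, t))) =
        M.expectation (indicator ((\<lambda>A. A (i, t)) -` {-?a..?a} \<inter> space M))"
      by (intro Bochner_Integration.integral_cong) (auto split: split_indicator)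
    also have "\<dots> = measure entry_law {-?a..?a}"
      using i t prob_entry[of "(i, t)" "{-?a..?a}"] by (simp add: Int_absorb1)
    also have "\<dots> \<le> ?a / (1 / sqrt d)" using d by (intro measure_normal_interval_le) auto
    also have "\<dots> = 1 / 16" using d by simp
    finally show "M.expectation (\<lambda>A. indicator {-?a..?a} (A (i, t))) \<le> (1 / 16 :: real)" .
  qed
  finally have E: "M.expectation C \<le> d / 16" by simp
  have "{A \<in> space M. L2_set (\<lambda>i. A (i, t)) {..<d} < 1 / 32} \<subseteq> {A \<in> space M. C A \<ge> 3 * d / 4}"
  proof safe
    fix A assume "L2_set (\<lambda>i. A (i, t)) {..<d} < 1 / 32"
    then have "sqrt (\<Sum>i<d. (A (i, t))\<^sup>2) < sqrt ((1 / 32)\<^sup>2)" by (simp add: L2_set_def)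
    then have "(\<Sum>i<d. (A (i, t))\<^sup>2) < (1 / 32)\<^sup>2" by (rule real_sqrt_less_iff[THEN iffD1])
    moreover have "(\<Sum>i<d. ?a\<^sup>2 * (1 - indicator {-?a..?a} (A (i, t)))) \<le> (\<Sum>i<d. (A (i, t))\<^sup>2)"
    proof (rule sum_mono)
      fix i
      have "?a\<^sup>2 \<le> (A (i, t))\<^sup>2" if "A (i, t) \<notin> {-?a..?a}"
      proof -
        have "?a \<le> \<bar>A (i, t)\<bar>" using that unfolding atLeastAtMost_iff by linarith
        then have "?a\<^sup>2 \<le> \<bar>A (i, t)\<bar>\<^sup>2" by (intro power_mono) auto
        then show ?thesis by simp
      qed
      then show "?a\<^sup>2 * (1 - indicator {-?a..?a} (A (i, t))) \<le> (A (i, t))\<^sup>2"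
        by (auto split: split_indicator)
    qed
    moreover have "(\<Sum>i<d. ?a\<^sup>2 * (1 - indicator {-?a..?a} (A (i, t)))) = ?a\<^sup>2 * (d - C A)"
      unfolding C_def sum_distrib_left[symmetric] sum_subtractf by simp
    moreover have "(1 / 32)\<^sup>2 = (1 / 1024 :: real)" by (simp add: power_divide)
    ultimately have "?a\<^sup>2 * (d - C A) < 1 / 1024" by linarith
    then have "d - C A < d / 4" using d by (simp add: power_divide power_mult_distrib field_simps)
    then show "3 * d / 4 \<le> C A" by simp
  qed
  moreover have [measurable]: "C \<in> borel_measurable M" unfolding C_def by measurable
  ultimately have "M.prob {A \<in> space M. L2_set (\<lambda>i. A (i, t)) {..<d} < 1 / 32} \<le>
      M.prob {A \<in> space M. C A \<ge> 3 * d / 4}"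
    by (intro M.finite_measure_mono) measurable
  also have "\<dots> \<le> M.expectation C / (3 * d / 4)"
    using d int unfolding C_def
    by (intro integral_Markov_inequality_measure[where A = "space M"]) (auto intro!: sum_nonneg)
  also have "\<dots> \<le> (d / 16) / (3 * d / 4)" using E d by (intro divide_right_mono) auto
  also have "\<dots> = 1 / 12" using d by simp
  finally show ?thesis .
qed

text \<open>The sum is a nondegenerate normal variable, hence has a density and avoids 0 almost
  surely.\<close>

lemma AE_row_nonzero:
  assumes j: "j < m" "x j \<noteq> (0::real)"
  shows "AE A in M. (\<Sum>j<m. A (0, j) * x j) \<noteq> 0"
proof -
  \<comment> \<open>Vanishing coordinates are dropped, because their terms would be constants
    without a density.\<close>
  define I where "I = {0::nat} \<times> {j. j < m \<and> x j \<noteq> 0}"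
  have I: "finite I" "I \<noteq> {}" "I \<subseteq> {..<d} \<times> {..<m}" using j d by (auto simp: I_def)
  define Z where "Z A = (\<Sum>ij\<in>I. x (snd ij) * A ij)" for A
  have "distributed M lborel (\<lambda>A. x (snd ij) * A ij) (normal_density 0 (\<bar>x (snd ij)\<bar> * (1 / sqrt d)))"
    if "ij \<in> I" for ij
  proof -
    have "distr M lborel (\<lambda>A. A ij) = distr M entry_law (\<lambda>A. A ij)" by (intro distr_cong) auto
    also have "\<dots> = entry_law"
      unfolding gaussian_matrix_def using that I prob_space_entry by (intro distr_PiM_component) auto
    finally have "distributed M lborel (\<lambda>A. A ij) (normal_density 0 (1 / sqrt d))"
      using that I measurable_entry[of ij] by (auto simp: distributed_def)
    from M.normal_density_affine[OF this, of "x (snd ij)" 0] that d show ?thesis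
      by (auto simp: I_def)
  qed
  moreover have "M.indep_vars (\<lambda>_. borel) (\<lambda>ij A. x (snd ij) * A ij) I"
    using M.indep_vars_subset[OF indep_entries I(3)] j
    by (intro M.indep_vars_compose2[where Y = "\<lambda>ij y. x (snd ij) * y" and X = "\<lambda>ij A. A ij"]) auto
  ultimately have "distributed M lborel Z
      (normal_density (\<Sum>ij\<in>I. 0) (sqrt (\<Sum>ij\<in>I. (\<bar>x (snd ij)\<bar> * (1 / sqrt d))\<^sup>2)))"
    unfolding Z_def using I d by (intro M.sum_indep_normal) (auto simp: I_def)
  then obtain f where f: "distributed M lborel Z f" by blast
  have "emeasure M (Z -` {0} \<inter> space M) = (\<integral>\<^sup>+y. f y * indicator {0} y \<partial>lborel)"
    by (rule distributed_emeasure[OF f]) auto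
  also have "\<dots> = 0" by (rule nn_integral_null_set) auto
  finally have "AE A in M. Z A \<noteq> 0"
    using distributed_measurable[OF f] by (intro AE_I[of _ _ "Z -` {0} \<inter> space M"]) auto
  moreover have "Z A = (\<Sum>j<m. A (0, j) * x j)" for A
  proof -
    have "Z A = (\<Sum>j | j < m \<and> x j \<noteq> 0. A (0, j) * x j)"
      unfolding Z_def I_def
      by (rule sum.reindex_bij_witness[of _ "\<lambda>j. (0, j)" snd]) (auto simp: mult.commute)
    also have "\<dots> = (\<Sum>j<m. A (0, j) * x j)" by (rule sum.mono_neutral_left) auto
    finally show ?thesis .
  qed
  ultimately show ?thesis by simp
qed

end

subsection \<open>The clustered snowflake\<close>

lemma pseudometric_length_edist: "pseudometric_length (\<lambda>a b. edist k (f a) (f b))"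
proof
  fix a b c
  show "edist k (f a) (f b) = edist k (f b) (f a)" by (rule edist_commute)
  show "0 \<le> edist k (f a) (f b)" "edist k (f a) (f a) = 0" by (simp_all add: edist_def L2_set_def sum_nonneg)
  have "f a i - f c i = (f a i - f b i) + (f b i - f c i)" for i by simp
  then show "edist k (f a) (f c) \<le> edist k (f a) (f b) + edist k (f b) (f c)"
    unfolding edist_def by (metis (no_types, lifting) L2_set_cong L2_set_triangle_ineq)
qed

lemma edist_eq_0_iff:
  assumes "x \<in> Rvec k" "y \<in> Rvec k"
  shows "edist k x y = 0 \<longleftrightarrow> x = y"
proof
  assume "edist k x y = 0"
  then have *: "x i = y i" if "i < k" for i using that by (simp add: edist_def L2_set_eq_0_iff)
  show "x = y"
  proof
    fix i show "x i = y i" using * assms by (cases "i < k") (auto simp: mem_Rvec_iff)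
  qed
qed (simp add: edist_def L2_set_def)

text \<open>
  The partial sums \<open>e\<^sub>0 + \<dots> + e\<^sub>t\<^sub>-\<^sub>1\<close> of an orthonormal sequence are at mutual distance \<open>sqrt \<bar>s - t\<bar>\<close>, so
  they form a doubling set although consecutive differences point in independent directions.
\<close>

definition snowflake_point :: "nat \<Rightarrow> nat \<Rightarrow> real \<Rightarrow> nat \<Rightarrow> real" where
  "snowflake_point P t y = (\<lambda>j. if j < t then 1 else if j = P then y else 0)"

lemma snowflake_point_in_Rvec: "t \<le> P \<Longrightarrow> snowflake_point P t y \<in> Rvec (Suc P)"
  by (auto simp: mem_Rvec_iff snowflake_point_def)

lemma edist_snowflake_point:
  assumes "s \<le> P" "t \<le> P"
  shows "edist (Suc P) (snowflake_point P s y) (snowflake_point P t z) =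
    sqrt (\<bar>real s - real t\<bar> + (y - z)\<^sup>2)"
proof -
  have le: "(\<Sum>j<P. (snowflake_point P s y j - snowflake_point P t z j)\<^sup>2) = real t - real s"
    if "s \<le> t" "t \<le> P" for s t y z
  proof -
    have "(\<Sum>j<P. (snowflake_point P s y j - snowflake_point P t z j)\<^sup>2) = (\<Sum>j\<in>{s..<t}. 1)"
      using that by (intro sum.mono_neutral_cong_right) (auto simp: snowflake_point_def)
    then show ?thesis using that by (simp add: of_nat_diff)
  qed
  have "(\<Sum>j<P. (snowflake_point P s y j - snowflake_point P t z j)\<^sup>2) = \<bar>real s - real t\<bar>"
    using le[of s t y z] le[of t s z y] assms
    by (cases "s \<le> t") (simp_all add: power2_commute)
  then show ?thesis
    using assms by (simp add: edist_def L2_set_def) (simp add: snowflake_point_def)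
qed

lemma lin_map_snowflake_point:
  assumes "t \<le> P" "i < d"
  shows "lin_map d (Suc P) A (snowflake_point P t y) i = (\<Sum>j<t. A (i, j)) + y * A (i, P)"
proof -
  have "(\<Sum>j<P. A (i, j) * snowflake_point P t y j) = (\<Sum>j<t. A (i, j))"
    using assms by (intro sum.mono_neutral_cong_right) (auto simp: snowflake_point_def)
  then show ?thesis using assms by (simp add: lin_map_def) (simp add: snowflake_point_def)
qed

text \<open>The axes \<open>0, ..., P - 1\<close> carry the steps and the axis \<open>P\<close> the
  direction \<open>u\<close>. \<open>P + 2 \<le> n\<close> gives every cluster its center, and the
  bound on \<epsilon> keeps offsets below 1 and the total length of all in-cluster edges at most
  1.\<close>

locale cluster_construction = random_projection d "Suc P" for d P :: nat +
  fixes n :: nat and \<epsilon> :: real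
  assumes P: "1 \<le> P" and n: "P + 2 \<le> n" and \<epsilon>: "0 < \<epsilon>" "\<epsilon> * n\<^sup>2 \<le> 1"
begin

text \<open>
  Point \<open>k\<close> lies in cluster \<open>k mod q\<close>. Clusters \<open>0, \<dots>, P\<close> sit at the partial sums, and cluster \<open>P + 1\<close>
  sits at \<open>P e\<^sub>P\<close>. Within a cluster the points are spaced by \<open>\<epsilon>\<close> in the direction \<open>e\<^sub>P\<close>.
\<close>

abbreviation "q \<equiv> P + 2"
definition "pos k = (if k mod q \<le> P then k mod q else 0)"
definition "elev k = (if k mod q \<le> P then 0 else real P) + \<epsilon> * real (k div q)"
definition "pt k = snowflake_point P (pos k) (elev k)"
definition "X = pt ` {..<n}"
definition "G A = lin_map d (Suc P) A"
definition "\<sigma> A k l = edist d (G A (pt k)) (G A (pt l))"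
definition "\<rho> k l = edist (Suc P) (pt k) (pt l)"

lemma pos_le: "pos k \<le> P" by (simp add: pos_def)

lemma pt_in_Rvec: "pt k \<in> Rvec (Suc P)"
  by (simp add: pt_def snowflake_point_in_Rvec pos_le)

lemma \<rho>_eq: "\<rho> k l = sqrt (\<bar>real (pos k) - real (pos l)\<bar> + (elev k - elev l)\<^sup>2)"
  by (simp add: \<rho>_def pt_def edist_snowflake_point pos_le)

lemma \<epsilon>n: "\<epsilon> * n \<le> 1"
proof -
  have "real n * 1 \<le> real n * real n" using n by (intro mult_left_mono) auto
  then have "\<epsilon> * real n \<le> \<epsilon> * (real n)\<^sup>2" using \<epsilon>(1) by (simp add: power2_eq_square)
  then show ?thesis using \<epsilon>(2) by simp
qed

lemma offset_less_1: "k < n \<Longrightarrow> \<epsilon> * real (k div q) < 1"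
proof -
  assume "k < n"
  then have "k div q < n" by (rule le_less_trans[OF div_le_dividend])
  then have "real (k div q) < real n" by (rule of_nat_less_iff[THEN iffD2])
  then have "\<epsilon> * real (k div q) < \<epsilon> * real n" using \<epsilon> by simp
  then show ?thesis using \<epsilon>n by linarith
qed

text \<open>Clusters \<open>0\<close> and \<open>P + 1\<close> share the value
  \<open>pos = 0\<close>; the elevation separates them, as offsets stay below
  \<open>1 \<le> P\<close>. After that both \<open>k mod q\<close> and \<open>k div q\<close> can be
  read off.\<close>

lemma inj_pt: "inj_on pt {..<n}"
proof (rule inj_onI)
  fix k l assume kl: "k \<in> {..<n}" "l \<in> {..<n}" "pt k = pt l"
  then have "\<rho> k l = 0" by (simp add: \<rho>_def edist_def L2_set_def)
  then have "\<bar>real (pos k) - real (pos l)\<bar> + (elev k - elev l)\<^sup>2 = 0" by (simp add: \<rho>_eq)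
  then have eq: "pos k = pos l" "elev k = elev l"
    by (smt (verit) of_nat_eq_iff zero_le_power2, smt (verit) zero_le_power2 zero_eq_power2)
  have "0 \<le> \<epsilon> * real (k div q)" "0 \<le> \<epsilon> * real (l div q)" using \<epsilon> by simp_all
  then have iff: "k mod q \<le> P \<longleftrightarrow> l mod q \<le> P"
    using eq(2) offset_less_1[of k] offset_less_1[of l] kl(1,2) P
    by (auto simp: elev_def split: if_splits)
  have "k mod q < q" "l mod q < q" by simp_all
  then have "k mod q = l mod q"
  proof (cases "k mod q \<le> P")
    case True
    then show ?thesis using iff eq(1) by (simp add: pos_def)
  next
    case False
    then have "k mod q = Suc P" "l mod q = Suc P"
      using iff \<open>k mod q < q\<close> \<open>l mod q < q\<close> by linarith+
    then show ?thesis by simp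
  qed
  moreover have "k div q = l div q" using eq(2) iff \<epsilon> by (auto simp: elev_def split: if_splits)
  ultimately show "k = l" by (metis div_mult_mod_eq)
qed

lemma card_X: "card X = n"
  using card_image[OF inj_pt] by (simp add: X_def)

lemma doubling_dim_X: "doubling_dim (edist (Suc P)) X \<le> 8"
proof -
  have "doubling_constant (edist (Suc P)) X \<le> 153"
  proof (rule snowflake_line_doubling)
    fix a b assume "a \<in> X" "b \<in> X"
    then obtain k l where kl: "k < n" "l < n" "a = pt k" "b = pt l" by (auto simp: X_def)
    \<comment> \<open>The snowflake and line coordinates of a point are read off its unique
      index.\<close>
    have "inv_into {..<n} pt a = k" "inv_into {..<n} pt b = l"
      using kl inv_into_f_f[OF inj_pt] by auto
    then show "edist (Suc P) a b = sqrt (\<bar>real (pos (inv_into {..<n} pt a)) - real (pos (inv_into {..<n} pt b))\<bar>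
        + (elev (inv_into {..<n} pt a) - elev (inv_into {..<n} pt b))\<^sup>2)"
      using \<rho>_eq[of k l] kl by (simp add: \<rho>_def)
  qed
  \<comment> \<open>The source of the dimension bound 8: the smallest power of two above 153 is
    \<open>2 ^ 8\<close>.\<close>
  then have "doubling_constant (edist (Suc P)) X \<le> 2 ^ 8" by simp
  from doubling_dim_le[OF this] show ?thesis by simp
qed

sublocale \<rho>: pseudometric_length \<rho>
  unfolding \<rho>_def by (rule pseudometric_length_edist)

sublocale \<sigma>: pseudometric_length "\<sigma> A" for A
  unfolding \<sigma>_def by (rule pseudometric_length_edist)

lemma \<rho>_same_cluster:
  assumes "k mod q = l mod q"
  shows "\<rho> k l = \<epsilon> * \<bar>real (k div q) - real (l div q)\<bar>"
proof -
  have "elev k - elev l = \<epsilon> * (real (k div q) - real (l div q))" "pos k = pos l"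
    using assms by (simp_all add: elev_def pos_def algebra_simps)
  then show ?thesis using \<epsilon> by (simp add: \<rho>_eq abs_mult)
qed

text \<open>An explicit tree: a path of \<open>P\<close> unit steps through the centers, one edge of
  length \<open>P\<close> to the remote center, and every other point on its own center. The last
  edges cost at most \<open>1 \<le> P\<close> together.\<close>

lemma mst_cost_X_le: "mst_cost (edist (Suc P)) X \<le> 3 * P"
proof -
  define par where "par k = (if k \<le> P then k - 1 else if k = Suc P then 0 else k mod q)" for k
  have par: "par k < k" if "1 \<le> k" for k
  proof -
    have "k mod q < q" by simp
    then have "k mod q < k" if "q \<le> k" using that by linarith
    then show ?thesis using that by (auto simp: par_def)
  qed
  \<comment> \<open>The empty set is the trivial tree on \<open>{0}\<close>, from which all other
    points are hung.\<close>
  let ?T = "{} \<union> (\<lambda>k. {k, par k}) ` {1..<n}"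
  have T0: "is_spanning_tree {..<1::nat} {}"
    using spanning_tree_singleton[of "0::nat"] by (simp add: lessThan_Suc)
  have "mst_cost (edist (Suc P)) X = mst_cost \<rho> {..<n}"
    unfolding X_def \<rho>_def using inj_pt edist_commute by (rule mst_cost_image)
  also have "\<dots> \<le> tree_cost \<rho> ?T"
    using n par by (intro \<rho>.mst_cost_le spanning_tree_add_leaves[OF T0]) auto
  also have "\<dots> = tree_cost \<rho> {} + (\<Sum>k=1..<n. \<rho> k (par k))"
    using par by (intro tree_cost_add_leaves[OF \<rho>.symmetric_length_axioms T0]) auto
  also have "\<dots> = (\<Sum>k=1..<n. \<rho> k (par k))" by (simp add: tree_cost_def)
  also have "\<dots> \<le> (\<Sum>k=1..<n. (if k \<le> P then 1 else 0) + (if k = Suc P then real P else 0) + \<epsilon> * n)"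
  proof (rule sum_mono)
    fix k assume k: "k \<in> {1..<n}"
    have en: "0 \<le> \<epsilon> * real n" using \<epsilon> by simp
    consider "k \<le> P" | "k = Suc P" | "q \<le> k" by linarith
    then show "\<rho> k (par k) \<le> (if k \<le> P then 1 else 0) + (if k = Suc P then real P else 0) + \<epsilon> * n"
    proof cases
      case 1
      then have "\<rho> k (par k) = 1"
        using k by (simp add: \<rho>_eq par_def pos_def elev_def of_nat_diff)
      then show ?thesis using 1 k en by simp
    next
      case 2
      then have "\<rho> k (par k) = P" by (simp add: \<rho>_eq par_def pos_def elev_def)
      then show ?thesis using 2 en by simp
    next
      case 3
      have "\<rho> k (par k) = \<epsilon> * real (k div q)"
        using 3 by (simp add: par_def \<rho>_same_cluster)
      also have "\<dots> \<le> \<epsilon> * n"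
        using k \<epsilon> div_le_dividend[of k q] by (intro mult_left_mono) (auto simp del: div_le_dividend)
      finally show ?thesis using 3 by simp
    qed
  qed
  also have "\<dots> \<le> P + P + n * (\<epsilon> * n)"
  proof -
    have "{1..<n} \<inter> {k. k \<le> P} = {1..P}" "Suc P \<in> {1..<n}" using n by auto
    moreover have "real (n - 1) * (\<epsilon> * n) \<le> n * (\<epsilon> * n)"
      using \<epsilon> by (intro mult_right_mono) auto
    ultimately show ?thesis by (simp add: sum.distrib sum.If_cases sum.delta)
  qed
  also have "n * (\<epsilon> * n) \<le> 1" using \<epsilon>(2) by (simp add: power2_eq_square mult_ac)
  finally show ?thesis using P by simp
qed

lemma G_diff:
  assumes "i < d"
  shows "G A (pt k) i - G A (pt l) i =
    (\<Sum>j<pos k. A (i, j)) - (\<Sum>j<pos l. A (i, j)) + (elev k - elev l) * A (i, P)"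
  using assms by (simp add: G_def pt_def lin_map_snowflake_point pos_le algebra_simps)

lemma \<sigma>_same_pos:
  assumes "pos k = pos l"
  shows "\<sigma> A k l = \<bar>elev k - elev l\<bar> * L2_set (\<lambda>i. A (i, P)) {..<d}"
proof -
  have "\<sigma> A k l = L2_set (\<lambda>i. (elev k - elev l) * A (i, P)) {..<d}"
    unfolding \<sigma>_def edist_def using assms by (intro L2_set_cong) (auto simp: G_diff)
  also have "\<dots> = sqrt ((elev k - elev l)\<^sup>2 * (\<Sum>i<d. (A (i, P))\<^sup>2))"
    by (simp add: L2_set_def power_mult_distrib sum_distrib_left)
  finally show ?thesis by (simp add: real_sqrt_mult L2_set_def)
qed

lemma \<sigma>_step:
  assumes "t < P"
  shows "\<sigma> A (Suc t) t = L2_set (\<lambda>i. A (i, t)) {..<d}"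
  unfolding \<sigma>_def edist_def using assms
  by (intro L2_set_cong) (auto simp: G_diff pos_def elev_def)

lemma \<sigma>_near:
  assumes "k < n"
  shows "\<sigma> A k (k mod q) \<le> \<epsilon> * n * L2_set (\<lambda>i. A (i, P)) {..<d}"
proof -
  have "real (k div q) \<le> real n" using assms div_le_dividend[of k q] by (simp del: div_le_dividend)
  then have "\<epsilon> * real (k div q) \<le> \<epsilon> * n" using \<epsilon> by simp
  moreover have "elev k - elev (k mod q) = \<epsilon> * real (k div q)" "pos k = pos (k mod q)"
    by (simp_all add: elev_def pos_def)
  ultimately show ?thesis
    using \<epsilon> by (simp add: \<sigma>_same_pos mult_right_mono)
qed

text \<open>The centers \<open>Suc P\<close> and \<open>0\<close> differ by exactly \<open>P\<close>
  times the last unit vector, so connecting them already costs this much.\<close>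

lemma mst_cost_\<sigma>_ge: "P * L2_set (\<lambda>i. A (i, P)) {..<d} \<le> mst_cost (\<sigma> A) {..<n}"
proof -
  have "\<sigma> A (Suc P) 0 = P * L2_set (\<lambda>i. A (i, P)) {..<d}"
    by (subst \<sigma>_same_pos) (simp_all add: pos_def elev_def)
  moreover have "\<sigma> A (Suc P) 0 \<le> mst_cost (\<sigma> A) {..<n}"
    using n by (intro \<sigma>.dist_le_mst_cost) auto
  ultimately show ?thesis by simp
qed

lemma cluster_separation:
  assumes "t < P" "k mod q = Suc t"
  shows "1 \<le> \<rho> k t"
proof -
  have "pos k = Suc t" "pos t = t" using assms by (auto simp: pos_def)
  then show ?thesis by (simp add: \<rho>_eq)
qed

section \<open>The bad event: measurability and probability\<close>

definition "span_trees = {T. is_spanning_tree {..<n} T}"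

lemma finite_span_trees: "finite span_trees"
proof -
  have "span_trees \<subseteq> Pow (Pow {..<n})" using spanning_tree_edges_in_Pow by (auto simp: span_trees_def)
  then show ?thesis by (rule finite_subset) simp
qed

definition "bad_event \<delta> K = {A \<in> space M. let G = lin_map d (Suc P) A in
  inj_on G X \<and>
  (\<exists>T. is_spanning_tree (G ` X) T \<and>
    tree_cost (edist d) T \<le> (1 + \<delta>) * mst_cost (edist d) (G ` X) \<and>
    tree_cost (edist (Suc P)) (pull_back G X T) \<ge> K * mst_cost (edist (Suc P)) X)}"

text \<open>Under injectivity all trees involved are images of trees on the fixed index set
  \<open>{..<n}\<close>, so the quantifier over trees no longer depends on the matrix. This form is
  used for measurability and for the probability bound.\<close>

lemma bad_event_eq:
  "bad_event \<delta> K = {A \<in> space M. inj_on (G A) X \<and>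
    (\<exists>T\<in>span_trees. tree_cost (\<sigma> A) T \<le> (1 + \<delta>) * mst_cost (\<sigma> A) {..<n} \<and>
      tree_cost \<rho> T \<ge> K * mst_cost (edist (Suc P)) X)}"
proof -
  have "(\<exists>T. is_spanning_tree (G A ` X) T \<and>
      tree_cost (edist d) T \<le> (1 + \<delta>) * mst_cost (edist d) (G A ` X) \<and>
      tree_cost (edist (Suc P)) (pull_back (G A) X T) \<ge> c) \<longleftrightarrow>
    (\<exists>T\<in>span_trees. tree_cost (\<sigma> A) T \<le> (1 + \<delta>) * mst_cost (\<sigma> A) {..<n} \<and> tree_cost \<rho> T \<ge> c)"
    if inj: "inj_on (G A) X" for A c
  proof -
    let ?f = "\<lambda>k. G A (pt k)"
    have f: "inj_on ?f {..<n}"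
      using comp_inj_on[OF inj_pt, of "G A"] inj by (simp add: X_def comp_def)
    have GX: "G A ` X = ?f ` {..<n}" by (auto simp: X_def)
    have span_trees: "{T. is_spanning_tree (G A ` X) T} = (`) ((`) ?f) ` span_trees"
      unfolding GX span_trees_def by (rule spanning_trees_image[OF f])
    have mst: "mst_cost (edist d) (G A ` X) = mst_cost (\<sigma> A) {..<n}"
      unfolding GX \<sigma>_def using f edist_commute by (rule mst_cost_image)
    have cost: "tree_cost (edist d) ((`) ?f ` T) = tree_cost (\<sigma> A) T" if "T \<in> span_trees" for T
      unfolding \<sigma>_def using that by (intro tree_cost_image[OF f] edist_commute) (simp add: span_trees_def)
    have pull: "tree_cost (edist (Suc P)) (pull_back (G A) X ((`) ?f ` T)) = tree_cost \<rho> T"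
      if "T \<in> span_trees" for T
    proof -
      have T: "is_spanning_tree {..<n} T" using that by (simp add: span_trees_def)
      have "pull_back (G A) X ((`) ?f ` T) = (`) pt ` T"
        unfolding X_def using inj inj_pt spanning_tree_edges_in_Pow[OF T]
        by (intro pull_back_image) (auto simp: X_def)
      then show ?thesis
        unfolding \<rho>_def using tree_cost_image[OF inj_pt T, of "edist (Suc P)"] edist_commute by metis
    qed
    have "(\<exists>T. is_spanning_tree (G A ` X) T \<and> Q T) \<longleftrightarrow> (\<exists>T\<in>span_trees. Q ((`) ?f ` T))" for Q
    proof -
      have "(\<exists>T. is_spanning_tree (G A ` X) T \<and> Q T) \<longleftrightarrow> (\<exists>T\<in>{T. is_spanning_tree (G A ` X) T}. Q T)"
        by simp
      then show ?thesis unfolding span_trees by simp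
    qed
    then show ?thesis using cost pull mst by auto
  qed
  then show ?thesis
    unfolding bad_event_def Let_def G_def[symmetric] by blast
qed

lemma measurable_\<sigma> [measurable]: "(\<lambda>A. \<sigma> A k l) \<in> borel_measurable M"
proof -
  have [measurable]: "(\<lambda>A. A (i, j)) \<in> borel_measurable M" if "i < d" "j < Suc P" for i j
    using that by (intro measurable_entry) auto
  have "(\<lambda>A. \<sigma> A k l) = (\<lambda>A. sqrt (\<Sum>i<d. ((\<Sum>j<Suc P. A (i, j) * pt k j) - (\<Sum>j<Suc P. A (i, j) * pt l j))\<^sup>2))"
    by (simp add: \<sigma>_def edist_def L2_set_def G_def lin_map_def del: sum.lessThan_Suc)
  then show ?thesis by (simp del: sum.lessThan_Suc)
qed

lemma measurable_tree_cost:
  assumes "T \<in> span_trees"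
  shows "(\<lambda>A. tree_cost (\<sigma> A) T) \<in> borel_measurable M"
  unfolding tree_cost_def
proof (rule borel_measurable_sum)
  fix e assume "e \<in> T"
  then obtain u v where "e = {u, v}" using assms by (auto simp: span_trees_def is_spanning_tree_def)
  then show "(\<lambda>A. edge_length (\<sigma> A) e) \<in> borel_measurable M" by (simp add: \<sigma>.edge_length)
qed

lemma inj_on_iff_\<sigma>: "inj_on (G A) X \<longleftrightarrow> (\<forall>k\<in>{..<n}. \<forall>l\<in>{..<n}. k = l \<or> \<sigma> A k l \<noteq> 0)"
proof -
  have "\<sigma> A k l = 0 \<longleftrightarrow> G A (pt k) = G A (pt l)" for k l
    unfolding \<sigma>_def G_def by (intro edist_eq_0_iff lin_map_in_Rvec)
  moreover have "inj_on (G A) X \<longleftrightarrow> inj_on (\<lambda>k. G A (pt k)) {..<n}"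
    unfolding X_def comp_inj_on_iff[OF inj_pt] by (simp add: comp_def)
  ultimately show ?thesis unfolding inj_on_def by auto
qed

lemma bad_event_measurable:
  assumes "0 \<le> \<delta>"
  shows "bad_event \<delta> K \<in> sets M"
proof -
  \<comment> \<open>Comparison with the minimum becomes a finite conjunction over all trees;
    \<open>0 \<le> \<delta>\<close> makes the factor order preserving.\<close>
  have mst: "c \<le> (1 + \<delta>) * mst_cost (\<sigma> A) {..<n} \<longleftrightarrow> (\<forall>T\<in>span_trees. c \<le> (1 + \<delta>) * tree_cost (\<sigma> A) T)" for A c
  proof -
    have "{..<n} \<noteq> {}" using n by (auto simp: lessThan_empty_iff)
    then obtain T0 where "T0 \<in> span_trees" "tree_cost (\<sigma> A) T0 = mst_cost (\<sigma> A) {..<n}"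
      using \<sigma>.mst_cost_attained[OF finite_lessThan] by (metis span_trees_def mem_Collect_eq)
    moreover have "(1 + \<delta>) * mst_cost (\<sigma> A) {..<n} \<le> (1 + \<delta>) * tree_cost (\<sigma> A) T" if "T \<in> span_trees" for T
      using that assms by (intro mult_left_mono \<sigma>.mst_cost_le) (auto simp: span_trees_def)
    ultimately show ?thesis by (metis order_trans)
  qed
  have "{A \<in> space M. (\<forall>k\<in>{..<n}. \<forall>l\<in>{..<n}. k = l \<or> \<sigma> A k l \<noteq> 0) \<and>
    (\<exists>T\<in>span_trees. (\<forall>T'\<in>span_trees. tree_cost (\<sigma> A) T \<le> (1 + \<delta>) * tree_cost (\<sigma> A) T') \<and>
      tree_cost \<rho> T \<ge> K * mst_cost (edist (Suc P)) X)} \<in> sets M"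
  proof (intro sets.sets_Collect_conj sets.sets_Collect_countable_All' sets.sets_Collect_countable_Ex'
      sets.sets_Collect_const countable_finite finite_span_trees finite_lessThan)
    show "{A \<in> space M. k = l \<or> \<sigma> A k l \<noteq> 0} \<in> sets M" for k l by measurable
    show "{A \<in> space M. tree_cost (\<sigma> A) T \<le> (1 + \<delta>) * tree_cost (\<sigma> A) T'} \<in> sets M"
      if "T \<in> span_trees" "T' \<in> span_trees" for T T'
      using that by (intro borel_measurable_le borel_measurable_times measurable_tree_cost) auto
  qed
  then show ?thesis
    unfolding bad_event_eq inj_on_iff_\<sigma> mst .
qed

text \<open>For each of the finitely many pairs of distinct points, the first row of the matrix
  separates the images almost surely.\<close>

lemma AE_inj_on: "AE A in M. inj_on (G A) X"
proof -
  have "AE A in M. k = l \<or> \<sigma> A k l \<noteq> 0" if "k \<in> {..<n}" "l \<in> {..<n}" for k l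
  proof (cases "k = l")
    case False
    then have "pt k \<noteq> pt l" using inj_onD[OF inj_pt] that by blast
    then obtain j where j: "pt k j \<noteq> pt l j" by auto
    then have "j < Suc P" using pt_in_Rvec[of k] pt_in_Rvec[of l]
      by (metis mem_Rvec_iff not_le)
    then have "AE A in M. (\<Sum>j<Suc P. A (0, j) * (pt k j - pt l j)) \<noteq> 0"
      using j AE_row_nonzero[of j "\<lambda>j. pt k j - pt l j"] by simp
    then show ?thesis
    proof (rule AE_mp, intro AE_I2 impI disjI2)
      fix A :: "nat \<times> nat \<Rightarrow> real" assume *: "(\<Sum>j<Suc P. A (0, j) * (pt k j - pt l j)) \<noteq> 0"
      have "G A (pt k) 0 - G A (pt l) 0 = (\<Sum>j<Suc P. A (0, j) * (pt k j - pt l j))"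
        using d by (simp add: G_def lin_map_def right_diff_distrib sum_subtractf del: sum.lessThan_Suc)
      then have "G A (pt k) \<noteq> G A (pt l)" using * by auto
      then show "\<sigma> A k l \<noteq> 0"
        unfolding \<sigma>_def G_def by (subst edist_eq_0_iff) (auto intro: lin_map_in_Rvec)
    qed
  qed simp
  then show ?thesis
    unfolding inj_on_iff_\<sigma> by (intro AE_finite_allI finite_lessThan)
qed

text \<open>Up to a null set the event can fail only if \<open>G u\<close> is short
  (\<open>B1\<close>, probability at most 1/12) or no step is short (\<open>B2\<close>, at most
  1/4), in total at most 1/3. Otherwise \<open>bad_tree_exists\<close> applies at a short step
  \<open>t\<close>.\<close>

lemma bad_event_prob:
  fixes N :: nat and \<delta> K r :: real
  assumes "0 \<le> \<delta>" "0 \<le> K" and r: "0 \<le> r" "r \<le> 1"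
    and many: "2 \<le> P * (r / 3) ^ d"
    and size: "q * Suc N \<le> n" and NK: "3 * K * P \<le> N"
    and small: "(2 * real n ^ 2 + n) * (\<epsilon> * n) + 32 * N * r \<le> \<delta> * P"
  shows "2 / 3 \<le> M.prob (bad_event \<delta> K)"
proof -
  let ?U = "\<lambda>A. L2_set (\<lambda>i. A (i, P)) {..<d}"
  define B1 where "B1 = {A \<in> space M. ?U A < 1 / 32}"
  define B2 where "B2 = {A \<in> space M. \<forall>t<P. \<exists>i<d. \<bar>A (i, t)\<bar> > r / sqrt d}"
  have [measurable]: "(\<lambda>A. A (i, j)) \<in> borel_measurable M" if "i < d" "j < Suc P" for i j
    using that by (intro measurable_entry) auto
  have B1: "B1 \<in> sets M" unfolding B1_def L2_set_def by measurable
  have B2: "B2 \<in> sets M"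
  proof -
    have "B2 = {A \<in> space M. \<forall>t\<in>{..<P}. \<exists>i\<in>{..<d}. \<bar>A (i, t)\<bar> > r / sqrt d}" by (auto simp: B2_def)
    also have "\<dots> \<in> sets M" by measurable
    finally show ?thesis .
  qed
  have p1: "M.prob B1 \<le> 1 / 12" unfolding B1_def by (rule prob_small_column) simp
  have "M.prob B2 \<le> exp (- (real P * (r / 3) ^ d))"
    unfolding B2_def using P r by (intro prob_no_short_column) auto
  \<comment> \<open>\<open>P\<close> times the probability of a short column is at least 2.\<close>
  also have "\<dots> \<le> exp (- 2)" using many by simp
  also have "\<dots> \<le> 1 / 4"
  proof -
    have "(2::real) \<le> exp 1" using exp_ge_add_one_self[of 1] by simp
    then have "2 * 2 \<le> exp 1 * exp (1::real)" by (intro mult_mono) auto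
    then have "4 \<le> exp (2::real)" by (simp flip: exp_add)
    then show ?thesis by (simp add: exp_minus field_simps)
  qed
  finally have p2: "M.prob B2 \<le> 1 / 4" .
  have "AE A in M. A \<in> space M - (B1 \<union> B2) \<longrightarrow> A \<in> bad_event \<delta> K"
    using AE_inj_on
  proof (rule AE_mp, intro AE_I2 impI)
    fix A assume A: "A \<in> space M" "inj_on (G A) X" "A \<in> space M - (B1 \<union> B2)"
    let ?u = "?U A"
    have u: "1 / 32 \<le> ?u" using A(1,3) by (auto simp: B1_def)
    obtain t where t: "t < P" and "\<not> (\<exists>i<d. \<bar>A (i, t)\<bar> > r / sqrt d)"
      using A(1,3) unfolding B2_def by blast
    then have column: "\<bar>A (i, t)\<bar> \<le> r / sqrt d" if "i < d" for i using that by force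
    have short: "\<sigma> A (Suc t) t \<le> r"
    proof -
      have "(\<Sum>i<d. (A (i, t))\<^sup>2) \<le> (\<Sum>i<d. (r / sqrt d)\<^sup>2)"
        using column r by (intro sum_mono) (simp add: abs_le_square_iff[symmetric])
      also have "\<dots> = r\<^sup>2" using d by (simp add: power_divide)
      finally show ?thesis
        using r by (simp add: \<sigma>_step[OF t] L2_set_def real_le_lsqrt)
    qed
    have tq: "Suc t < q" using t by simp
    obtain T where T: "is_spanning_tree {..<n} T"
      "tree_cost (\<sigma> A) T \<le> mst_cost (\<sigma> A) {..<n} + (2 * real n ^ 2 + n) * (\<epsilon> * n * ?u) + N * r"
      "real N \<le> tree_cost \<rho> T"
      by (rule bad_tree_exists[OF \<sigma>.pseudometric_length_axioms \<rho>.symmetric_length_axioms tq size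
            \<sigma>_near short cluster_separation[OF t]])
    \<comment> \<open>\<open>32 * ?u \<ge> 1\<close> turns the whole error into a multiple of
      \<open>?u\<close>, so that it can be compared with the lower bound \<open>P * ?u\<close> for
      the minimum cost.\<close>
    have "N * r * 1 \<le> N * r * (32 * ?u)" using u r by (intro mult_left_mono) auto
    then have "(2 * real n ^ 2 + n) * (\<epsilon> * n * ?u) + N * r \<le>
        ((2 * real n ^ 2 + n) * (\<epsilon> * n) + 32 * N * r) * ?u" by (simp add: algebra_simps)
    also have "\<dots> \<le> \<delta> * P * ?u" using small u by (intro mult_right_mono) auto
    also have "\<dots> \<le> \<delta> * mst_cost (\<sigma> A) {..<n}"
      using mst_cost_\<sigma>_ge[of A] assms(1) by (simp add: mult.assoc mult_left_mono)
    finally have "tree_cost (\<sigma> A) T \<le> (1 + \<delta>) * mst_cost (\<sigma> A) {..<n}"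
      using T(2) by (simp add: algebra_simps)
    moreover have "K * mst_cost (edist (Suc P)) X \<le> K * (3 * P)"
      using mst_cost_X_le assms(2) by (intro mult_left_mono)
    then have "K * mst_cost (edist (Suc P)) X \<le> tree_cost \<rho> T"
      using NK T(3) by (simp add: mult_ac)
    ultimately show "A \<in> bad_event \<delta> K"
      using A(1,2) T(1) unfolding bad_event_eq by (auto simp: span_trees_def)
  qed
  then have "M.prob (space M - (B1 \<union> B2)) \<le> M.prob (bad_event \<delta> K)"
    using bad_event_measurable[OF assms(1)] by (intro M.finite_measure_mono_AE) auto
  moreover have "M.prob (space M - (B1 \<union> B2)) = 1 - M.prob (B1 \<union> B2)"
    using B1 B2 by (intro M.prob_compl) auto
  moreover have "M.prob (B1 \<union> B2) \<le> M.prob B1 + M.prob B2"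
    using B1 B2 by (rule measure_Un_le)
  ultimately show ?thesis using p1 p2 by linarith
qed

end

section \<open>Choice of parameters and passage to the limit\<close>

lemma bad_projection_exists:
  fixes d n :: nat and \<kappa> :: real
  assumes d: "d \<ge> 1" and \<kappa>: "1 \<le> \<kappa>" and n: "(768 * \<kappa>\<^sup>2) ^ (4 * d) = real n"
  shows "\<exists>m. \<exists>X \<subseteq> Rvec m. finite X \<and> card X = n \<and> doubling_dim (edist m) X \<le> 8 \<and>
    measure (gaussian_matrix d m)
      {A \<in> space (gaussian_matrix d m).
         let G = lin_map d m A in
         inj_on G X \<and>
         (\<exists>T. is_spanning_tree (G ` X) T \<and>
              tree_cost (edist d) T \<le> (1 + 1 / \<kappa>) * mst_cost (edist d) (G ` X) \<and>
              tree_cost (edist m) (pull_back G X T) \<ge> \<kappa> * mst_cost (edist m) X)} \<ge> 2 / 3"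
proof -
  \<comment> \<open>A short step has length \<open>r = 3 / B\<close>.
    \<open>P \<ge> 2 * B ^ d\<close> makes one likely, \<open>N \<ge> 3 * \<kappa> * P\<close> beats
    \<kappa> times the minimum cost, and 768 is what makes
    \<open>32 * (4 * \<kappa> * P) * (3 / B)\<close> equal to \<open>P / (2 * \<kappa>)\<close>,
    half of the allowed excess.\<close>
  define B where "B = 768 * \<kappa>\<^sup>2"
  define P where "P = nat \<lceil>2 * B ^ d\<rceil>"
  define N where "N = nat \<lceil>3 * \<kappa> * P\<rceil>"
  \<comment> \<open>With this power the error from the cluster widths is at most
    \<open>3 / n\<close>, well within the other half of the excess.\<close>
  define \<epsilon> where "\<epsilon> = 1 / real n ^ 4"
  have \<kappa>2: "\<kappa> \<le> \<kappa>\<^sup>2" using \<kappa> by (simp add: power2_eq_square)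
  then have B: "768 * \<kappa> \<le> B" "1 \<le> B" using \<kappa> by (auto simp: B_def)
  have BBd: "B \<le> B ^ d" using d B(2) by (simp add: self_le_power)
  have nB: "real n = B ^ d * B ^ d * B ^ d * B ^ d"
    using n by (simp add: B_def mult.commute[of 4] power_mult power4_eq_xxxx)
  have n1: "1 \<le> real n"
    using one_le_power[OF B(2), of "4 * d"] n by (simp add: B_def)
  have P_bounds: "2 * B ^ d \<le> P" "P \<le> 3 * B ^ d"
    using B(2) BBd by (auto simp: P_def) linarith+
  have P1: "1 \<le> P" using P_bounds(1) B BBd by linarith
  have N: "3 * \<kappa> * P \<le> N" "real N + 1 \<le> 5 * \<kappa> * P"
  proof -
    have "1 * 1 \<le> \<kappa> * P" using \<kappa> P1 by (intro mult_mono) auto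
    then show "3 * \<kappa> * P \<le> N" "real N + 1 \<le> 5 * \<kappa> * P"
      unfolding N_def by linarith+
  qed
  \<comment> \<open>The count is at most \<open>135 * \<kappa> * B ^ (2 * d)\<close>; the spare
    factor \<open>B ^ (2 * d)\<close> in \<open>n\<close> absorbs \<open>135 * \<kappa>\<close>, as
    \<open>B \<ge> 768 * \<kappa>\<close>.\<close>
  have size: "(P + 2) * Suc N \<le> n"
  proof -
    have "real ((P + 2) * Suc N) = (real P + 2) * (real N + 1)" by (simp add: algebra_simps)
    also have "\<dots> \<le> (3 * real P) * (5 * \<kappa> * P)" using P1 N(2) \<kappa> by (intro mult_mono) auto
    also have "\<dots> = 15 * \<kappa> * (real P * real P)" by simp
    also have "\<dots> \<le> 15 * \<kappa> * ((3 * B ^ d) * (3 * B ^ d))"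
      using P_bounds B \<kappa> by (intro mult_left_mono mult_mono) auto
    also have "\<dots> = (135 * \<kappa>) * (B ^ d * B ^ d)" by simp
    also have "\<dots> \<le> (B ^ d * B ^ d) * (B ^ d * B ^ d)"
    proof (rule mult_right_mono)
      have "135 * \<kappa> \<le> B" using B \<kappa> by simp
      also have "\<dots> \<le> B ^ d" by (rule BBd)
      also have "\<dots> \<le> B ^ d * B ^ d" using B(2) BBd by simp
      finally show "135 * \<kappa> \<le> B ^ d * B ^ d" .
    qed simp
    also have "\<dots> = real n" using nB by simp
    finally show ?thesis by (simp only: of_nat_le_iff)
  qed
  interpret cluster_construction d P n \<epsilon>
  proof
    show "P + 2 \<le> n" using size by (simp add: add_leE)
    have "real n ^ 2 \<le> real n ^ 4" using n1 by (intro power_increasing) auto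
    then show "0 < \<epsilon>" "\<epsilon> * n\<^sup>2 \<le> 1" using n1 by (auto simp: \<epsilon>_def)
  qed (use d P1 in auto)
  have "2 / 3 \<le> M.prob (bad_event (1 / \<kappa>) \<kappa>)"
  proof (rule bad_event_prob[where r = "3 / B" and N = N])
    show "2 \<le> P * ((3 / B) / 3) ^ d" using P_bounds(1) B by (simp add: power_divide field_simps)
    have "(2 * real n ^ 2 + n) * (\<epsilon> * n) \<le> 3 * real n ^ 2 * (\<epsilon> * n)"
      using n1 by (intro mult_right_mono) (auto simp: \<epsilon>_def power2_eq_square)
    also have "\<dots> = 3 / n" using n1 by (simp add: \<epsilon>_def power2_eq_square power4_eq_xxxx)
    also have "\<dots> \<le> 3" using n1 by (simp add: field_simps)
    also have "3 \<le> P / (2 * \<kappa>)"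
      using P_bounds(1) BBd B(1) \<kappa> by (simp add: field_simps)
    finally have 1: "(2 * real n ^ 2 + n) * (\<epsilon> * n) \<le> P / (2 * \<kappa>)" .
    have "1 * 1 \<le> \<kappa> * P" using \<kappa> P1 by (intro mult_mono) auto
    then have "N \<le> 4 * \<kappa> * P" unfolding N_def by linarith
    then have "32 * N * (3 / B) \<le> 32 * (4 * \<kappa> * P) * (3 / B)"
      using B by (intro mult_right_mono) auto
    also have "\<dots> = P / (2 * \<kappa>)" using \<kappa> by (simp add: B_def power2_eq_square)
    finally have 2: "32 * N * (3 / B) \<le> P / (2 * \<kappa>)" .
    have "P / (2 * \<kappa>) + P / (2 * \<kappa>) = 1 / \<kappa> * P" using \<kappa> by (simp add: field_simps)
    then show "(2 * real n ^ 2 + n) * (\<epsilon> * n) + 32 * N * (3 / B) \<le> 1 / \<kappa> * P" using 1 2 by linarith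
  qed (use size N(1) \<kappa> B in auto)
  then show ?thesis
    using card_X doubling_dim_X pt_in_Rvec
    by (intro exI[of _ "Suc P"] exI[of _ X]) (auto simp: bad_event_def X_def)
qed

theorem lemma6p5:
  fixes d :: "nat \<Rightarrow> nat"
  assumes "\<And>n. d n \<ge> 1"
    and "(\<lambda>n. real (d n)) \<in> o(\<lambda>n. ln (real n))"
    and "(\<lambda>n. real (d n)) \<in> \<omega>(\<lambda>n. ln (ln (real n)))"
  shows "\<exists>(D::real) (\<delta> :: nat \<Rightarrow> real) (K :: nat \<Rightarrow> real).
    D > 0 \<and> \<delta> \<longlonglongrightarrow> 0 \<and> filterlim K at_top sequentially \<and>
    (\<forall>\<^sub>F n in sequentially. \<exists>m. \<exists>X \<subseteq> Rvec m.
       finite X \<and> card X = n \<and> doubling_dim (edist m) X \<le> D \<and>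
       measure (gaussian_matrix (d n) m)
         {A \<in> space (gaussian_matrix (d n) m).
            let G = lin_map (d n) m A in
            inj_on G X \<and>
            (\<exists>T. is_spanning_tree (G ` X) T \<and>
                 tree_cost (edist (d n)) T \<le> (1 + \<delta> n) * mst_cost (edist (d n)) (G ` X) \<and>
                 tree_cost (edist m) (pull_back G X T) \<ge> K n * mst_cost (edist m) X)}
       \<ge> 2 / 3)"
proof -
  \<comment> \<open>The solution of \<open>(768 * \<kappa>\<^sup>2) ^ (4 * d) = n\<close>. The
    witnesses are \<open>\<delta> = 1 / \<kappa>\<close>, \<open>K = \<kappa>\<close> and
    \<open>D = 8\<close>.\<close>
  define \<kappa> where "\<kappa> n = sqrt (exp (ln (real n) / (4 * d n)) / 768)" for n
  have pos: "\<forall>\<^sub>F n in sequentially. 0 < real (d n) / ln (real n)"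
    using eventually_gt_at_top[of 1]
  proof eventually_elim
    case (elim n)
    then show ?case using assms(1)[of n] by (simp add: Suc_le_eq)
  qed
  \<comment> \<open>\<open>d = o(ln n)\<close> says that this quotient tends to 0; being eventually
    positive, it has an inverse that tends to positive infinity.\<close>
  have "filterlim (\<lambda>n. inverse (real (d n) / ln (real n))) at_top sequentially"
    using smalloD_tendsto[OF assms(2)] pos by (rule filterlim_inverse_at_top)
  then have "filterlim (\<lambda>n. (1 / 4) * inverse (real (d n) / ln (real n))) at_top sequentially"
    by (intro filterlim_tendsto_pos_mult_at_top[OF tendsto_const]) auto
  then have "filterlim (\<lambda>n. ln (real n) / (4 * d n)) at_top sequentially" by simp
  from filterlim_compose[OF exp_at_top this]
  have "filterlim (\<lambda>n. (1 / 768) * exp (ln (real n) / (4 * d n))) at_top sequentially"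
    by (intro filterlim_tendsto_pos_mult_at_top[OF tendsto_const]) auto
  from filterlim_compose[OF sqrt_at_top this]
  have K: "filterlim \<kappa> at_top sequentially" by (simp add: \<kappa>_def[abs_def])
  then have \<delta>: "(\<lambda>n. 1 / \<kappa> n) \<longlonglongrightarrow> 0"
    by (intro tendsto_divide_0[OF tendsto_const] filterlim_at_top_imp_at_infinity)
  have "\<forall>\<^sub>F n in sequentially. 1 \<le> \<kappa> n"
    using K by (simp add: filterlim_at_top)
  then have "\<forall>\<^sub>F n in sequentially. 1 \<le> \<kappa> n \<and> (768 * (\<kappa> n)\<^sup>2) ^ (4 * d n) = real n"
    using eventually_gt_at_top[of 0]
  proof eventually_elim
    case (elim n)
    have "(768 * (\<kappa> n)\<^sup>2) ^ (4 * d n) = exp (ln (real n) / (4 * d n)) ^ (4 * d n)"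
      by (simp add: \<kappa>_def)
    also have "\<dots> = exp (real (4 * d n) * (ln (real n) / (4 * d n)))" by (rule exp_of_nat_mult[symmetric])
    also have "\<dots> = real n" using elim(2) assms(1)[of n] by simp
    finally show ?case using elim(1) by simp
  qed
  then have "\<forall>\<^sub>F n in sequentially. \<exists>m. \<exists>X \<subseteq> Rvec m.
       finite X \<and> card X = n \<and> doubling_dim (edist m) X \<le> 8 \<and>
       measure (gaussian_matrix (d n) m)
         {A \<in> space (gaussian_matrix (d n) m).
            let G = lin_map (d n) m A in
            inj_on G X \<and>
            (\<exists>T. is_spanning_tree (G ` X) T \<and>
                 tree_cost (edist (d n)) T \<le> (1 + 1 / \<kappa> n) * mst_cost (edist (d n)) (G ` X) \<and>
                 tree_cost (edist m) (pull_back G X T) \<ge> \<kappa> n * mst_cost (edist m) X)}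
       \<ge> 2 / 3"
  proof eventually_elim
    case (elim n)
    then show ?case using assms(1)[of n] by (intro bad_projection_exists) auto
  qed
  then show ?thesis
    using \<delta> K by (intro exI[of _ 8] exI[of _ "\<lambda>n. 1 / \<kappa> n"] exI[of _ \<kappa>] conjI) simp_all
qed

end
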